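(* If $G$ is an Eulerian graph and $A$ is a finite abelian group, then $G$ is $A$-flow-connected whenever $|A|\ge 62(56^2\cdot 27+27)+1=5{,}251{,}339$.
   Context: Graphs are finite; parallel edges are allowed. A graph is Eulerian if every vertex has even degree (connectedness is not required). A cycle is a connected 2-regular graph (two parallel edges form a cycle of length 2). Fix an arbitrary orientation $D$ of $G$; for a vertex $v$ let $E_D^+(v)$ and $E_D^-(v)$ be the sets of edges directed out of and into $v$. An $A$-flow on $G$ (always nowhere-zero here) is a function $f:E(G)\to A\setminus\{0_A\}$ with $\sum_{e\in E_D^+(v)}f(e)-\sum_{e\in E_D^-(v)}f(e)=0_A$ for every vertex $v$. (Flows given with different orientations are identified by negating the value of every edge whose orientation is reversed, so the choice of $D$ does not matter.) Two $A$-flows $f',f''$ are adjacent if there is a cycle $C$ in $G$ such that $f'(e)=f''(e)$ for all $e\notin E(C)$, and equivalent if they are joined by a finite sequence of $A$-flows in which consecutive flows are adjacent. $G$ is $A$-flow-connected if all its $A$-flows are pairwise equivalent. *)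

theory Defs
  imports "Graph_Theory.Digraph" "HOL-Library.FuncSet" "HOL-Library.Cardinality"
begin

record ('v, 'e) multigraph =
  vertices :: "'v set"
  edges :: "'e set"
  ends :: "'e \<Rightarrow> 'v set"

text \<open>Edges are named objects, so parallel edges are possible; loops are not
  (every edge has two distinct ends).\<close>

definition multigraph :: "('v, 'e, 'm) multigraph_scheme \<Rightarrow> bool" where
  "multigraph G \<longleftrightarrow> finite (vertices G) \<and> finite (edges G) \<and>
     (\<forall>e\<in>edges G. ends G e \<subseteq> vertices G \<and> card (ends G e) = 2)"

definition degree :: "('v, 'e, 'm) multigraph_scheme \<Rightarrow> 'v \<Rightarrow> nat" where
  "degree G v = card {e \<in> edges G. v \<in> ends G e}"

definition eulerian :: "('v, 'e, 'm) multigraph_scheme \<Rightarrow> bool" where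
  "eulerian G \<longleftrightarrow> (\<forall>v\<in>vertices G. even (degree G v))"

definition adjacency :: "('v, 'e, 'm) multigraph_scheme \<Rightarrow> ('v \<times> 'v) set" where
  "adjacency G = {(u, v). \<exists>e\<in>edges G. ends G e = {u, v}}"

definition connected_graph :: "('v, 'e, 'm) multigraph_scheme \<Rightarrow> bool" where
  "connected_graph G \<longleftrightarrow> vertices G \<noteq> {} \<and>
     (\<forall>u\<in>vertices G. \<forall>v\<in>vertices G. (u, v) \<in> (adjacency G)\<^sup>*)"

definition subgraph_of ::
  "('v, 'e, 'm) multigraph_scheme \<Rightarrow> ('v, 'e, 'n) multigraph_scheme \<Rightarrow> bool" where
  "subgraph_of H G \<longleftrightarrow> multigraph H \<and> vertices H \<subseteq> vertices G \<and> edges H \<subseteq> edges G \<and>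
     (\<forall>e\<in>edges H. ends H e = ends G e)"

definition cycle :: "('v, 'e, 'm) multigraph_scheme \<Rightarrow> bool" where
  "cycle C \<longleftrightarrow> multigraph C \<and> connected_graph C \<and> (\<forall>v\<in>vertices C. degree C v = 2)"

definition orientation ::
  "('v, 'e) pre_digraph \<Rightarrow> ('v, 'e, 'm) multigraph_scheme \<Rightarrow> bool" where
  "orientation D G \<longleftrightarrow> verts D = vertices G \<and> arcs D = edges G \<and>
     (\<forall>e\<in>edges G. ends G e = {tail D e, head D e})"

text \<open>Flows are taken in \<open>E \<rightarrow>\<^sub>E _\<close>, hence are \<open>undefined\<close> off the edge set, so that
  equality of HOL functions is equality of flows.\<close>

definition nz_flow :: "('v, 'e) pre_digraph \<Rightarrow> ('e \<Rightarrow> 'a::ab_group_add) \<Rightarrow> bool" where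
  "nz_flow D f \<longleftrightarrow> f \<in> arcs D \<rightarrow>\<^sub>E (UNIV - {0}) \<and>
     (\<forall>v\<in>verts D. (\<Sum>e\<in>out_arcs D v. f e) - (\<Sum>e\<in>in_arcs D v. f e) = 0)"

definition adjacent_flows ::
  "('v, 'e) multigraph \<Rightarrow> ('e \<Rightarrow> 'a) \<Rightarrow> ('e \<Rightarrow> 'a) \<Rightarrow> bool" where
  "adjacent_flows G f g \<longleftrightarrow>
     (\<exists>C::('v, 'e) multigraph. subgraph_of C G \<and> cycle C \<and>
        (\<forall>e\<in>edges G - edges C. f e = g e))"

definition equivalent_flows ::
  "('v, 'e) multigraph \<Rightarrow> ('v, 'e) pre_digraph \<Rightarrow>
   ('e \<Rightarrow> 'a::ab_group_add) \<Rightarrow> ('e \<Rightarrow> 'a) \<Rightarrow> bool" where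
  "equivalent_flows G D =
     (\<lambda>f g. nz_flow D f \<and> nz_flow D g \<and> adjacent_flows G f g)\<^sup>*\<^sup>*"

text \<open>The choice of orientation is immaterial; rather than selecting one, the definition
  asks for the property under all of them.\<close>

definition flow_connected :: "'a::ab_group_add itself \<Rightarrow> ('v, 'e) multigraph \<Rightarrow> bool" where
  "flow_connected A G \<longleftrightarrow>
     (\<forall>D. orientation D G \<longrightarrow>
        (\<forall>f g :: 'e \<Rightarrow> 'a. nz_flow D f \<longrightarrow> nz_flow D g \<longrightarrow> equivalent_flows G D f g))"

lemma orientation_exists:
  assumes "multigraph G"
  shows "\<exists>D. orientation D G"
proof -
  have "\<forall>e\<in>edges G. \<exists>p. ends G e = {fst p, snd p}"
    using assms by (fastforce simp: multigraph_def card_2_iff)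
  then obtain p where "\<forall>e\<in>edges G. ends G e = {fst (p e), snd (p e)}"
    by metis
  then have "orientation
      \<lparr>verts = vertices G, arcs = edges G, tail = fst \<circ> p, head = snd \<circ> p\<rparr> G"
    by (simp add: orientation_def)
  then show ?thesis by blast
qed

end

theory Submission
  imports Defs
begin

text \<open>
  Fix an orientation \<open>D\<close> of \<open>G\<close>. Adding a group element \<open>z\<close> along a cycle is a special case of passing
  from a flow \<open>f\<close> to \<open>f + k z\<close>, where \<open>k\<close> is an integer circulation with values in \<open>{-1, 0, 1}\<close>.
  Conversely such a \<^emph>\<open>shift\<close> is a sequence of cycle moves: the support of \<open>k\<close>, directed by the signs of
  \<open>k\<close>, splits into directed cycles, and if they are used one after the other, every arc only ever
  carries its value in \<open>f\<close> or its value in \<open>f + k z\<close>, neither of which is \<open>0\<close>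
  (\<open>shift_imp_equivalent_flows\<close>). So it suffices to connect all flows by shifts. Shifts are easier to
  handle because they survive changes of the digraph that preserve circulations.

  For a fixed \<open>a \<noteq> 0\<close>, call a flow constant if it is \<open>\<plusminus>a\<close> on every arc, with signs that form an
  Eulerian orientation. Two constant flows differ by a single shift, by \<open>a + a\<close>
  (\<open>shift_constants\<close>). That every flow reaches a constant one (\<open>even_digraph_reaches_constant\<close>) is
  shown by induction on the number of arcs. A loop can be deleted, and one of two arcs that form
  a cut can be contracted. If an arc \<open>d\<close> enters a vertex, an arc \<open>e\<close> leaves it, and the flow has the
  same value on both, then \<open>d\<close> and \<open>e\<close> can be merged into one arc, which keeps all degrees even. The
  heart of the proof is that a flow can always be shifted so that it agrees on such \<open>d\<close> and \<open>e\<close>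
  (\<open>shifts_equalize\<close>).

  At that point every nonempty cut has at least four arcs, so by matroid union there are disjoint
  arc sets \<open>I\<close> and \<open>J\<close>, both avoiding \<open>d\<close> and \<open>e\<close>, each of which connects everything that the whole
  digraph connects (\<open>two_disjoint_spanning\<close>). Outside such a set \<open>I\<close>, the support of a circulation
  can be prescribed. Hence a shift by \<open>p\<close> can be made to change exactly the chosen arcs outside \<open>I\<close>,
  up to an error set no larger than the number of arcs on which the flow is \<open>\<plusminus>p\<close>, where adding
  \<open>\<plusminus>p\<close> might create a zero (\<open>shift_along_cotree\<close>). Shifting by \<open>p\<close> relative to \<open>I\<close> and then by \<open>q\<close>
  relative to \<open>J\<close> controls every arc, and for generic \<open>p\<close> and \<open>q\<close> one can make the flow avoid a
  given small set \<open>B\<close> of values on all arcs, with an error of at most twice the number of arcs whose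
  value lies in the eight-element set \<open>octet p q\<close> (\<open>shifts_avoiding_up_to\<close>).

  The errors can be driven to zero. To avoid \<open>B\<close>, take three generic pairs \<open>(p, q)\<close> with disjoint
  octets. If the union of these octets can be avoided up to \<open>N\<close> arcs, then one octet is hit at most
  \<open>N/3\<close> times, so \<open>B\<close> can be avoided up to \<open>2N/3\<close> arcs. Since this holds for all small \<open>B\<close>, every
  small set can be avoided exactly (\<open>shifts_avoiding\<close>). Finally avoid octets, so that the next step is
  free of errors, put \<open>x = f e - f d\<close>, and avoid \<open>\<plusminus>x\<close> on all arcs other than \<open>d\<close> and \<open>e\<close>, which lie
  outside \<open>I\<close> and \<open>J\<close> and can be kept fixed. Then \<open>x\<close> can be added along a circulation that
  contains \<open>d\<close> and not \<open>e\<close>, and the two values agree.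

  The size of the group enters only through the generic choices, each of which has to dodge a bounded
  number of group elements, at most \<open>3024\<close> (\<open>ex_compatible\<close>).
\<close>

section \<open>Integer multiples in an abelian group\<close>

definition zmul :: "int \<Rightarrow> 'a::ab_group_add \<Rightarrow> 'a" where
  "zmul k z = (\<Sum>i<nat k. z) - (\<Sum>i<nat (- k). z)"

lemma zmul_0 [simp]: "zmul 0 z = 0"
  and zmul_1 [simp]: "zmul 1 z = z"
  and zmul_minus [simp]: "zmul (- k) z = - zmul k z"
  by (simp_all add: zmul_def)

lemma zmul_Suc: "zmul (k + 1) z = zmul k z + z"
proof (cases "k \<ge> 0")
  case True
  then have "nat (k + 1) = Suc (nat k)" by simp
  with True show ?thesis by (simp add: zmul_def algebra_simps)
next
  case False
  then have "nat (- k) = Suc (nat (- (k + 1)))" by simp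
  with False show ?thesis by (simp add: zmul_def algebra_simps)
qed

lemma zmul_add: "zmul (k + l) z = zmul k z + zmul l z"
proof (induction l rule: int_induct[where k = 0])
  case (step1 i)
  then show ?case using zmul_Suc[of "k + i" z] zmul_Suc[of i z] by (simp add: algebra_simps)
next
  case (step2 i)
  then show ?case using zmul_Suc[of "k + (i - 1)" z] zmul_Suc[of "i - 1" z]
    by (simp add: algebra_simps)
qed simp

lemma zmul_diff: "zmul (k - l) z = zmul k z - zmul l z"
  using zmul_add[of k "- l" z] by simp

lemma zmul_sum: "zmul (\<Sum>x\<in>X. k x) z = (\<Sum>x\<in>X. zmul (k x) z)"
  by (induction X rule: infinite_finite_induct) (simp_all add: zmul_add)

lemma zmul_unit_cases: "\<bar>k\<bar> \<le> 1 \<Longrightarrow> zmul k z = (if k = 0 then 0 else if k = 1 then z else - z)"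
proof -
  assume "\<bar>k\<bar> \<le> 1"
  then have "k = 0 \<or> k = 1 \<or> k = - 1" by linarith
  moreover have "zmul (- 1) z = - z" using zmul_minus[of 1 z] by simp
  ultimately show ?thesis by auto
qed

section \<open>Net outflow and circulations\<close>

text \<open>
  A set \<open>S\<close> of vertices, rather than a single vertex, is the argument: contracting an arc replaces
  \<open>S\<close> by a preimage, and the values across a cut are read off from its side.
\<close>

definition net_out :: "('v, 'e) pre_digraph \<Rightarrow> ('e \<Rightarrow> 'a::ab_group_add) \<Rightarrow> 'v set \<Rightarrow> 'a" where
  "net_out D f S =
     (\<Sum>e\<in>arcs D. (if tail D e \<in> S then f e else 0) - (if head D e \<in> S then f e else 0))"

definition circulation :: "('v, 'e) pre_digraph \<Rightarrow> ('e \<Rightarrow> 'a::ab_group_add) \<Rightarrow> bool" where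
  "circulation D f \<longleftrightarrow> (\<forall>v. net_out D f {v} = 0)"

text \<open>
  Modulo 2, the net outflow of the constant function 1 at a vertex is the degree, with loops counted
  twice. In this form evenness is inherited along every operation that preserves net outflow.
\<close>

definition even_digraph :: "('v, 'e) pre_digraph \<Rightarrow> bool" where
  "even_digraph D \<longleftrightarrow> (\<forall>v. even (net_out D (\<lambda>_. 1 :: int) {v}))"

definition cut :: "('v, 'e) pre_digraph \<Rightarrow> 'v set \<Rightarrow> 'e set" where
  "cut D S = {e \<in> arcs D. (tail D e \<in> S) \<noteq> (head D e \<in> S)}"

lemma net_out_cong:
  "(\<And>e. e \<in> arcs D \<Longrightarrow> f e = g e) \<Longrightarrow> net_out D f S = net_out D g S"
  unfolding net_out_def by (rule sum.cong) auto

lemma net_out_eq_sum: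
  assumes "finite S"
  shows "net_out D f S = (\<Sum>v\<in>S. net_out D f {v})"
proof -
  have "(\<Sum>v\<in>S. net_out D f {v}) = (\<Sum>e\<in>arcs D. \<Sum>v\<in>S.
      (if tail D e \<in> {v} then f e else 0) - (if head D e \<in> {v} then f e else 0))"
    unfolding net_out_def by (rule sum.swap)
  also have "\<dots> = net_out D f S"
    unfolding net_out_def using assms by (intro sum.cong) (auto simp: sum_subtractf)
  finally show ?thesis by simp
qed

lemma net_out_Int_verts: "wf_digraph D \<Longrightarrow> net_out D f (S \<inter> verts D) = net_out D f S"
  unfolding net_out_def
  by (rule sum.cong) (auto simp: wf_digraph.tail_in_verts wf_digraph.head_in_verts)

lemma net_out_eq_0:
  assumes "fin_digraph D" "circulation D f"
  shows "net_out D f S = 0"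
proof -
  interpret fin_digraph D by fact
  have "net_out D f (S \<inter> verts D) = 0"
    using assms(2) by (simp add: net_out_eq_sum[of "S \<inter> verts D"] circulation_def)
  then show ?thesis by (simp add: net_out_Int_verts wf_digraph)
qed

lemma even_net_out_one:
  assumes "fin_digraph D" "even_digraph D"
  shows "even (net_out D (\<lambda>_. 1 :: int) S)"
proof -
  interpret fin_digraph D by fact
  have "even (net_out D (\<lambda>_. 1 :: int) (S \<inter> verts D))"
    unfolding net_out_eq_sum[of "S \<inter> verts D", OF finite_Int[OF disjI2, OF finite_verts]]
    using assms(2) by (auto simp: even_digraph_def intro!: dvd_sum)
  then show ?thesis by (simp add: net_out_Int_verts wf_digraph)
qed

lemma net_out_cut:
  assumes "finite (arcs D)"
  shows "net_out D f S = (\<Sum>e\<in>cut D S. if tail D e \<in> S then f e else - f e)"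
proof -
  have "net_out D f S = (\<Sum>e\<in>cut D S. (if tail D e \<in> S then f e else 0) - (if head D e \<in> S then f e else 0))"
    unfolding net_out_def using assms
    by (intro sum.mono_neutral_right) (auto simp: cut_def)
  also have "\<dots> = (\<Sum>e\<in>cut D S. if tail D e \<in> S then f e else - f e)"
    by (rule sum.cong) (auto simp: cut_def)
  finally show ?thesis .
qed

lemma even_card_cut:
  assumes "fin_digraph D" "even_digraph D"
  shows "even (card (cut D S))"
proof -
  interpret fin_digraph D by fact
  have "even (\<Sum>e\<in>cut D S. if tail D e \<in> S then 1 else - 1 :: int)"
    using even_net_out_one[OF assms, of S] by (simp add: net_out_cut)
  moreover have "odd (if tail D e \<in> S then 1 else - 1 :: int)" for e by simp
  moreover have "finite (cut D S)" by (simp add: cut_def)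
  ultimately show ?thesis by (subst (asm) even_sum_iff) auto
qed

lemma net_out_add: "net_out D (\<lambda>e. f e + g e) S = net_out D f S + net_out D g S"
  unfolding net_out_def sum.distrib[symmetric] by (rule sum.cong) auto

lemma net_out_minus: "net_out D (\<lambda>e. - f e) S = - net_out D f S"
  unfolding net_out_def sum_negf[symmetric] by (rule sum.cong) auto

lemma net_out_sum: "net_out D (\<lambda>e. \<Sum>i\<in>I. f i e) S = (\<Sum>i\<in>I. net_out D (f i) S)"
  by (induction I rule: infinite_finite_induct) (auto simp: net_out_add net_out_def)

lemma net_out_zmul: "net_out D (\<lambda>e. zmul (k e) z) S = zmul (net_out D k S) z"
  unfolding net_out_def zmul_sum by (rule sum.cong) (auto simp: zmul_diff)

lemma circulation_add: "circulation D f \<Longrightarrow> circulation D g \<Longrightarrow> circulation D (\<lambda>e. f e + g e)"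
  by (simp add: circulation_def net_out_add)

lemma circulation_minus: "circulation D f \<Longrightarrow> circulation D (\<lambda>e. - f e)"
  by (simp add: circulation_def net_out_minus)

lemma circulation_sum: "(\<And>i. i \<in> I \<Longrightarrow> circulation D (f i)) \<Longrightarrow> circulation D (\<lambda>e. \<Sum>i\<in>I. f i e)"
  by (simp add: circulation_def net_out_sum)

lemma circulation_zmul: "circulation D k \<Longrightarrow> circulation D (\<lambda>e. zmul (k e) z)"
  by (simp add: circulation_def net_out_zmul)

lemma circulation_cong:
  "(\<And>e. e \<in> arcs D \<Longrightarrow> f e = g e) \<Longrightarrow> circulation D f \<longleftrightarrow> circulation D g"
  by (simp add: circulation_def net_out_cong[of D f g])

section \<open>Operations on arcs\<close>

text \<open>
  Meant for \<open>head D e = tail D e'\<close>: the two arcs become one, which keeps the name \<open>e\<close> and bypasses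
  the common vertex. A loop arises if \<open>e'\<close> returns to the tail of \<open>e\<close>.
\<close>

definition splice_arcs :: "('v, 'e) pre_digraph \<Rightarrow> 'e \<Rightarrow> 'e \<Rightarrow> ('v, 'e) pre_digraph" where
  "splice_arcs D e e' = D\<lparr>arcs := arcs D - {e'}, head := (head D)(e := head D e')\<rparr>"

text \<open>
  Unless \<open>e\<close> is a loop, its head stays behind as an isolated vertex, so that the vertex set does not
  change.
\<close>

definition contract :: "('v, 'e) pre_digraph \<Rightarrow> 'e \<Rightarrow> ('v, 'e) pre_digraph" where
  "contract D e = (let m = (id(head D e := tail D e)) in
     D\<lparr>arcs := arcs D - {e}, tail := m \<circ> tail D, head := m \<circ> head D\<rparr>)"

definition flip :: "('v, 'e) pre_digraph \<Rightarrow> 'e \<Rightarrow> ('v, 'e) pre_digraph" where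
  "flip D e = D\<lparr>tail := (tail D)(e := head D e), head := (head D)(e := tail D e)\<rparr>"

lemma fin_digraph_delete: "fin_digraph D \<Longrightarrow> fin_digraph (pre_digraph.del_arc D e)"
  unfolding fin_digraph_def wf_digraph_def fin_digraph_axioms_def pre_digraph.del_arc_def by auto

lemma fin_digraph_splice_arcs: "fin_digraph D \<Longrightarrow> e' \<in> arcs D \<Longrightarrow> fin_digraph (splice_arcs D e e')"
  unfolding fin_digraph_def wf_digraph_def fin_digraph_axioms_def splice_arcs_def by auto

lemma fin_digraph_contract: "fin_digraph D \<Longrightarrow> e \<in> arcs D \<Longrightarrow> fin_digraph (contract D e)"
  unfolding fin_digraph_def wf_digraph_def fin_digraph_axioms_def contract_def Let_def by auto

lemma fin_digraph_flip: "fin_digraph D \<Longrightarrow> fin_digraph (flip D e)"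
  unfolding fin_digraph_def wf_digraph_def fin_digraph_axioms_def flip_def by auto

lemma net_out_del_loop:
  assumes "finite (arcs D)" "e \<in> arcs D" "tail D e = head D e"
  shows "net_out (pre_digraph.del_arc D e) f S = net_out D f S"
  unfolding net_out_def pre_digraph.del_arc_def using assms
  by (simp add: sum.remove[of "arcs D" e])

lemma net_out_splice_arcs:
  assumes "finite (arcs D)" "e \<in> arcs D" "e' \<in> arcs D" "e \<noteq> e'" "head D e = tail D e'"
    and "f e = f e'"
  shows "net_out (splice_arcs D e e') f S = net_out D f S"
proof -
  define A where "A = arcs D - {e, e'}"
  have A: "finite A" "e \<notin> A" "e' \<notin> A" "arcs D = insert e' (insert e A)"
    using assms(1-3) by (auto simp: A_def)
  let ?g = "\<lambda>x. (if tail D x \<in> S then f x else 0) - (if head D x \<in> S then f x else 0)"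
  have "net_out D f S = (?g e' + ?g e) + (\<Sum>x\<in>A. ?g x)"
    unfolding net_out_def A(4) using A assms(4) by (simp add: add.assoc)
  also have "?g e' + ?g e = (if tail D e \<in> S then f e else 0) - (if head D e' \<in> S then f e else 0)"
    using assms(5,6) by auto
  finally have "net_out D f S = \<dots> + (\<Sum>x\<in>A. ?g x)" .
  moreover have "arcs (splice_arcs D e e') = insert e A"
    using A assms(4) by (auto simp: splice_arcs_def)
  then have "net_out (splice_arcs D e e') f S = (if tail D e \<in> S then f e else 0)
      - (if head D e' \<in> S then f e else 0)
      + (\<Sum>x\<in>A. (if tail D x \<in> S then f x else 0) - (if head (splice_arcs D e e') x \<in> S then f x else 0))"
    unfolding net_out_def using A by (simp add: splice_arcs_def)
  moreover have "(\<Sum>x\<in>A. (if tail D x \<in> S then f x else 0) - (if head (splice_arcs D e e') x \<in> S then f x else 0))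
      = (\<Sum>x\<in>A. ?g x)"
    using A(2) by (intro sum.cong) (auto simp: splice_arcs_def)
  ultimately show ?thesis by simp
qed

lemma net_out_contract:
  assumes "finite (arcs D)" "e \<in> arcs D"
  shows "net_out (contract D e) f S = net_out D f ((id(head D e := tail D e)) -` S)"
  unfolding net_out_def contract_def Let_def using assms
  by (simp add: sum.remove[of "arcs D" e])

lemma net_out_flip:
  assumes "e \<in> arcs D" "finite (arcs D)"
  shows "net_out (flip D e) (f(e := - f e)) S = net_out D f S"
  unfolding net_out_def
  using assms by (intro sum.cong) (auto simp: flip_def)

lemma even_digraph_flip: "fin_digraph D \<Longrightarrow> e \<in> arcs D \<Longrightarrow> even_digraph (flip D e) \<longleftrightarrow> even_digraph D"
proof -
  assume "fin_digraph D" and e: "e \<in> arcs D"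
  then interpret fin_digraph D by simp
  have "even (net_out (flip D e) (\<lambda>_. 1 :: int) S) \<longleftrightarrow> even (net_out D (\<lambda>_. 1 :: int) S)" for S
  proof -
    have "net_out D (\<lambda>_. 1 :: int) S = net_out (flip D e) (\<lambda>x. 1 + (if x = e then - 2 else 0)) S"
      using net_out_flip[OF e finite_arcs, of "\<lambda>_. 1 :: int" S, symmetric]
      by (auto intro!: arg_cong[where f = "\<lambda>f. net_out _ f S"])
    also have "\<dots> = net_out (flip D e) (\<lambda>_. 1) S + net_out (flip D e) (\<lambda>x. if x = e then - 2 else 0) S"
      by (rule net_out_add)
    finally have "net_out D (\<lambda>_. 1 :: int) S = \<dots>" .
    moreover have "even (net_out (flip D e) (\<lambda>x. if x = e then - 2 :: int else 0) S)"
      unfolding net_out_def by (rule dvd_sum) auto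
    ultimately show ?thesis by simp
  qed
  then show ?thesis by (simp add: even_digraph_def)
qed

section \<open>Circulations with values in -1, 0, 1\<close>

text \<open>
  The Eulerian orientation of an even graph. While some arc is not a loop, evenness yields a second
  arc at its head; splicing the two, after a reversal if they both enter the vertex, leaves a smaller
  even digraph, whose orientation lifts back.
\<close>

lemma even_digraph_unit_circulation:
  "fin_digraph D \<Longrightarrow> even_digraph D \<Longrightarrow> \<exists>k :: 'e \<Rightarrow> int. circulation D k \<and> (\<forall>e\<in>arcs D. \<bar>k e\<bar> = 1)"
  for D :: "('v, 'e) pre_digraph"
proof (induction "card (arcs D)" arbitrary: D rule: less_induct)
  case (less D)
  then interpret fin_digraph D by simp
  have splice_case: "\<exists>k :: 'e \<Rightarrow> int. circulation H k \<and> (\<forall>e\<in>arcs H. \<bar>k e\<bar> = 1)"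
    if H: "fin_digraph H" "even_digraph H" "card (arcs H) = card (arcs D)"
      and e: "e \<in> arcs H" "e' \<in> arcs H" "e \<noteq> e'" "head H e = tail H e'" for H :: "('v, 'e) pre_digraph" and e e'
  proof -
    have fin: "finite (arcs H)" using H(1) by (simp add: fin_digraph.finite_arcs)
    have "even_digraph (splice_arcs H e e')"
      using H(2) net_out_splice_arcs[OF fin e, of "\<lambda>_. 1 :: int"] by (simp add: even_digraph_def)
    moreover have "card (arcs (splice_arcs H e e')) < card (arcs D)"
      using card_Diff1_less[OF fin e(2)] H(3) by (simp add: splice_arcs_def)
    ultimately obtain k :: "'e \<Rightarrow> int" where k: "circulation (splice_arcs H e e') k"
        "\<forall>x\<in>arcs (splice_arcs H e e'). \<bar>k x\<bar> = 1"
      using less.hyps[OF _ fin_digraph_splice_arcs[OF H(1) e(2)]] by auto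
    have "circulation (splice_arcs H e e') (k(e' := k e))"
      using k(1) by (subst circulation_cong[of _ _ k]) (auto simp: splice_arcs_def)
    then have "circulation H (k(e' := k e))"
      using net_out_splice_arcs[OF fin e, of "k(e' := k e)"] e(3) by (simp add: circulation_def)
    then show ?thesis
      using k(2) e by (intro exI[of _ "k(e' := k e)"]) (auto simp: splice_arcs_def)
  qed
  show ?case
  proof (cases "\<exists>e\<in>arcs D. tail D e \<noteq> head D e")
    case False
    then have "circulation D (\<lambda>_. 1 :: int)"
      by (auto simp: circulation_def net_out_def intro!: sum.neutral)
    then show ?thesis by (intro exI[of _ "\<lambda>_. 1"]) auto
  next
    case True
    then obtain e where e: "e \<in> arcs D" "tail D e \<noteq> head D e" by blast
    let ?v = "head D e"
    have "cut D {?v} \<noteq> {e}"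
      using even_card_cut[OF less.prems, of "{?v}"] by auto
    moreover have "e \<in> cut D {?v}" using e by (auto simp: cut_def)
    ultimately obtain e' where e': "e' \<in> cut D {?v}" "e' \<noteq> e" by blast
    show ?thesis
    proof (cases "tail D e' = ?v")
      case True
      then show ?thesis using splice_case[OF less.prems refl e(1), of e'] e' by (auto simp: cut_def)
    next
      case False
      have e'D: "e' \<in> arcs D" using e' by (auto simp: cut_def)
      have "\<exists>k :: 'e \<Rightarrow> int. circulation (flip D e') k \<and> (\<forall>x\<in>arcs (flip D e'). \<bar>k x\<bar> = 1)"
      proof (rule splice_case[of _ e e'])
        show "fin_digraph (flip D e')" "even_digraph (flip D e')"
          using less.prems e'D by (simp_all add: fin_digraph_flip even_digraph_flip)
      qed (use e e' False in \<open>auto simp: flip_def cut_def\<close>)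
      then obtain k :: "'e \<Rightarrow> int" where k: "circulation (flip D e') k" "\<forall>x\<in>arcs D. \<bar>k x\<bar> = 1"
        by (auto simp: flip_def)
      have "circulation D (k(e' := - k e'))"
        using k(1) net_out_flip[OF e'D finite_arcs, of "k(e' := - k e')"] by (simp add: circulation_def)
      then show ?thesis
        using k(2) by (intro exI[of _ "k(e' := - k e')"]) auto
    qed
  qed
qed

text \<open>
  The arcs with odd value form an even digraph, which has an Eulerian orientation.
\<close>

lemma circulation_mod_2:
  fixes g :: "'e \<Rightarrow> int"
  assumes "fin_digraph D" "circulation D g"
  obtains k :: "'e \<Rightarrow> int" where "circulation D k" "\<And>e. \<bar>k e\<bar> \<le> 1" "\<And>e. e \<in> arcs D \<Longrightarrow> k e \<noteq> 0 \<longleftrightarrow> odd (g e)"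
proof -
  interpret fin_digraph D by fact
  let ?O = "D\<lparr>arcs := {e \<in> arcs D. odd (g e)}\<rparr>"
  have O: "fin_digraph ?O" using assms(1)
    unfolding fin_digraph_def wf_digraph_def fin_digraph_axioms_def by auto
  have restr: "net_out ?O f S = net_out D (\<lambda>e. if odd (g e) then f e else 0) S" for f :: "'e \<Rightarrow> int" and S
    unfolding net_out_def by (rule sum.mono_neutral_cong_left) auto
  have "even (net_out ?O (\<lambda>_. 1 :: int) {v})" for v
  proof -
    have "even (net_out D (\<lambda>e. (if odd (g e) then 1 else 0) + g e) {v})"
      unfolding net_out_def by (rule dvd_sum) auto
    then show ?thesis using assms(2) by (simp add: restr net_out_add circulation_def)
  qed
  then obtain k :: "'e \<Rightarrow> int" where k: "circulation ?O k" "\<forall>e\<in>arcs ?O. \<bar>k e\<bar> = 1"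
    using even_digraph_unit_circulation[OF O] by (auto simp: even_digraph_def)
  show ?thesis
  proof (rule that[of "\<lambda>e. if e \<in> arcs D \<and> odd (g e) then k e else 0"])
    have "circulation D (\<lambda>e. if odd (g e) then k e else 0)" using k(1) by (simp add: circulation_def restr)
    then show "circulation D (\<lambda>e. if e \<in> arcs D \<and> odd (g e) then k e else 0)"
      by (rule iffD1[OF circulation_cong, rotated]) auto
  qed (use k(2) in auto)
qed

section \<open>Matroid union\<close>

text \<open>
  The rank function of a matroid, with integer values so that contraction is a plain subtraction.
\<close>

locale rank_function =
  fixes E :: "'e set" and r :: "'e set \<Rightarrow> int"
  assumes finite_ground: "finite E"
    and rank_empty: "r {} = 0"
    and rank_mono: "X \<subseteq> Y \<Longrightarrow> Y \<subseteq> E \<Longrightarrow> r X \<le> r Y"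
    and rank_submodular: "X \<subseteq> E \<Longrightarrow> Y \<subseteq> E \<Longrightarrow> r (X \<union> Y) + r (X \<inter> Y) \<le> r X + r Y"
    and rank_singleton: "e \<in> E \<Longrightarrow> r {e} \<le> 1"
begin

lemma rank_function_subset:
  assumes "F \<subseteq> E"
  shows "rank_function F r"
proof
  fix X Y assume "X \<subseteq> Y" "Y \<subseteq> F"
  then show "r X \<le> r Y" using assms by (intro rank_mono) auto
next
  fix X Y assume "X \<subseteq> F" "Y \<subseteq> F"
  then show "r (X \<union> Y) + r (X \<inter> Y) \<le> r X + r Y" using assms by (intro rank_submodular) auto
qed (use assms finite_ground finite_subset rank_empty rank_singleton in auto)

lemma rank_function_contract:
  assumes "e \<in> E" "r {e} = 1"
  shows "rank_function (E - {e}) (\<lambda>X. r (insert e X) - 1)"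
proof
  fix X Y assume "X \<subseteq> E - {e}" "Y \<subseteq> E - {e}"
  then show "r (insert e (X \<union> Y)) - 1 + (r (insert e (X \<inter> Y)) - 1)
      \<le> r (insert e X) - 1 + (r (insert e Y) - 1)"
    using rank_submodular[of "insert e X" "insert e Y"] assms(1) by (simp add: subset_insertI2 Diff_eq)
next
  fix x assume x: "x \<in> E - {e}"
  then have "r ({x} \<union> {e}) + r ({x} \<inter> {e}) \<le> r {x} + r {e}"
    using assms(1) by (intro rank_submodular) auto
  then show "r (insert e {x}) - 1 \<le> 1"
    using x rank_singleton[of x] assms(2) rank_empty by (simp add: insert_commute)
next
  fix X Y assume "X \<subseteq> Y" "Y \<subseteq> E - {e}"
  then have "r (insert e X) \<le> r (insert e Y)" using assms(1) by (intro rank_mono) auto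
  then show "r (insert e X) - 1 \<le> r (insert e Y) - 1" by simp
qed (use finite_ground assms in auto)

lemma rank_insert_loop:
  assumes "e \<in> E" "r {e} = 0" "X \<subseteq> E - {e}"
  shows "r (insert e X) = r X"
proof -
  have "r ({e} \<union> X) + r ({e} \<inter> X) \<le> r {e} + r X" using assms by (intro rank_submodular) auto
  moreover have "{e} \<inter> X = {}" using assms by auto
  moreover have "r X \<le> r (insert e X)" using assms by (intro rank_mono) auto
  ultimately show ?thesis using assms(2) rank_empty by simp
qed

lemma rank_singleton_cases: "e \<in> E \<Longrightarrow> r {e} = 0 \<or> r {e} = 1"
  using rank_mono[of "{}" "{e}"] rank_singleton[of e] rank_empty by auto

end

text \<open>
  Induction on the ground set. An element \<open>e\<close> is put into \<open>I\<close> (contract it for \<open>r\<close>, delete it for \<open>s\<close>) or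
  into \<open>J\<close> (the other way round). If both choices violate the rank inequality, on \<open>X\<close> and on \<open>Y\<close>, then
  submodularity contradicts that inequality on \<open>X \<union> Y\<close> with \<open>e\<close> and on \<open>X \<inter> Y\<close>. Elements of rank \<open>0\<close> cannot
  be contracted; those of rank \<open>0\<close> for both functions are dropped.
\<close>

lemma matroid_union:
  assumes "rank_function E r" "rank_function E s"
    and "\<And>X. X \<subseteq> E \<Longrightarrow> m \<le> r X + s X + int (card (E - X))"
  shows "\<exists>I J. I \<subseteq> E \<and> J \<subseteq> E \<and> I \<inter> J = {} \<and> r I = int (card I) \<and> s J = int (card J)
    \<and> m \<le> int (card I) + int (card J)"
proof -
  have "finite E" using assms(1) by (simp add: rank_function.finite_ground)
  then show ?thesis using assms
  proof (induction E arbitrary: r s m rule: finite_psubset_induct)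
    case (psubset E)
    interpret r: rank_function E r by fact
    interpret s: rank_function E s by fact
    show ?case
    proof (cases "E = {}")
      case True
      then show ?thesis using psubset.prems(3)[of "{}"] r.rank_empty s.rank_empty by auto
    next
      case False
      then obtain e where e: "e \<in> E" by blast
      let ?E = "E - {e}"
      have sub: "?E \<subset> E" using e by auto
      have card_add: "card (?E - X) + card (?E - Y) + 1 = card (E - insert e (X \<union> Y)) + card (E - (X \<inter> Y))"
        if "X \<subseteq> ?E" "Y \<subseteq> ?E" for X Y
      proof -
        have "card (?E - X) + card (?E - Y) = card ((?E - X) \<union> (?E - Y)) + card ((?E - X) \<inter> (?E - Y))"
          using psubset.hyps by (intro card_Un_Int) auto
        moreover have "(?E - X) \<inter> (?E - Y) = E - insert e (X \<union> Y)" by auto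
        moreover have "E - (X \<inter> Y) = insert e ((?E - X) \<union> (?E - Y))" using that e by auto
        ultimately show ?thesis using psubset.hyps by simp
      qed
      \<comment> \<open>The rank inequality that remains after putting \<open>e\<close> into \<open>I\<close>, respectively into \<open>J\<close>; the summand
        \<open>-1\<close> from the contraction cancels against the decrease of \<open>m\<close>.\<close>
      define first where "first \<longleftrightarrow> (\<forall>X\<subseteq>?E. m \<le> r (insert e X) + s X + int (card (?E - X)))"
      define second where "second \<longleftrightarrow> (\<forall>X\<subseteq>?E. m \<le> r X + s (insert e X) + int (card (?E - X)))"
      have "first \<or> second"
      proof (rule ccontr)
        assume "\<not> ?thesis"
        then obtain X Y where XY: "X \<subseteq> ?E" "Y \<subseteq> ?E"
          "r (insert e X) + s X + int (card (?E - X)) < m"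
          "r Y + s (insert e Y) + int (card (?E - Y)) < m"
          by (auto simp: first_def second_def not_le)
        have "r (insert e X \<union> Y) + r (insert e X \<inter> Y) \<le> r (insert e X) + r Y"
          using XY e by (intro r.rank_submodular) auto
        moreover have "s (X \<union> insert e Y) + s (X \<inter> insert e Y) \<le> s X + s (insert e Y)"
          using XY e by (intro s.rank_submodular) auto
        moreover have "insert e X \<inter> Y = X \<inter> Y" "X \<inter> insert e Y = X \<inter> Y" using XY by auto
        moreover have "m \<le> r (insert e (X \<union> Y)) + s (insert e (X \<union> Y)) + int (card (E - insert e (X \<union> Y)))"
          using XY e by (intro psubset.prems(3)) auto
        moreover have "m \<le> r (X \<inter> Y) + s (X \<inter> Y) + int (card (E - (X \<inter> Y)))"
          using XY by (intro psubset.prems(3)) auto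
        ultimately show False using card_add[OF XY(1,2)] XY(3,4) by simp
      qed
      consider "first" "r {e} = 1" | "second" "s {e} = 1" | "r {e} = 0" "s {e} = 0"
        | "first" "r {e} = 0" "s {e} = 1" | "second" "r {e} = 1" "s {e} = 0"
        using \<open>first \<or> second\<close> r.rank_singleton_cases[OF e] s.rank_singleton_cases[OF e] by (elim disjE) simp_all
      then show ?thesis
      proof cases
        case 1
        have hyp: "m - 1 \<le> (r (insert e X) - 1) + s X + int (card (?E - X))" if "X \<subseteq> ?E" for X
          using 1(1)[unfolded first_def, THEN spec, THEN mp, OF that] by simp
        have "\<exists>I J. I \<subseteq> ?E \<and> J \<subseteq> ?E \<and> I \<inter> J = {} \<and> r (insert e I) - 1 = int (card I)
            \<and> s J = int (card J) \<and> m - 1 \<le> int (card I) + int (card J)"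
          by (rule psubset.IH[where r = "\<lambda>X. r (insert e X) - 1" and s = s and m = "m - 1",
              OF sub r.rank_function_contract[OF e 1(2)] s.rank_function_subset[OF Diff_subset]])
            (rule hyp)
        then obtain I J where IJ: "I \<subseteq> ?E" "J \<subseteq> ?E" "I \<inter> J = {}" "r (insert e I) - 1 = int (card I)"
          "s J = int (card J)" "m - 1 \<le> int (card I) + int (card J)" by blast
        moreover have "finite I" "e \<notin> I" using IJ(1,2) finite_subset[of I E] psubset.hyps by auto
        ultimately show ?thesis using e by (intro exI[of _ "insert e I"] exI[of _ J]) auto
      next
        case 2
        have hyp: "m - 1 \<le> r X + (s (insert e X) - 1) + int (card (?E - X))" if "X \<subseteq> ?E" for X
          using 2(1)[unfolded second_def, THEN spec, THEN mp, OF that] by simp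
        have "\<exists>I J. I \<subseteq> ?E \<and> J \<subseteq> ?E \<and> I \<inter> J = {} \<and> r I = int (card I)
            \<and> s (insert e J) - 1 = int (card J) \<and> m - 1 \<le> int (card I) + int (card J)"
          by (rule psubset.IH[where r = r and s = "\<lambda>X. s (insert e X) - 1" and m = "m - 1",
              OF sub r.rank_function_subset[OF Diff_subset] s.rank_function_contract[OF e 2(2)]])
            (rule hyp)
        then obtain I J where IJ: "I \<subseteq> ?E" "J \<subseteq> ?E" "I \<inter> J = {}" "r I = int (card I)"
          "s (insert e J) - 1 = int (card J)" "m - 1 \<le> int (card I) + int (card J)" by blast
        moreover have "finite J" "e \<notin> J" using IJ(1,2) finite_subset[of J E] psubset.hyps by auto
        ultimately show ?thesis using e by (intro exI[of _ I] exI[of _ "insert e J"]) auto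
      next
        case 3
        have "m \<le> r X + s X + int (card (?E - X))" if "X \<subseteq> ?E" for X
        proof -
          have "E - insert e X = ?E - X" by auto
          then show ?thesis
            using psubset.prems(3)[of "insert e X"] that e r.rank_insert_loop[OF e 3(1) that]
              s.rank_insert_loop[OF e 3(2) that] by auto
        qed
        then have "\<exists>I J. I \<subseteq> ?E \<and> J \<subseteq> ?E \<and> I \<inter> J = {} \<and> r I = int (card I)
            \<and> s J = int (card J) \<and> m \<le> int (card I) + int (card J)"
          by (intro psubset.IH[where r = r and s = s and m = m, OF sub r.rank_function_subset[OF Diff_subset] s.rank_function_subset[OF Diff_subset]])
        then obtain I J where "I \<subseteq> ?E" "J \<subseteq> ?E" "I \<inter> J = {}" "r I = int (card I)"
          "s J = int (card J)" "m \<le> int (card I) + int (card J)" by (elim exE conjE)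
        then show ?thesis by (intro exI[of _ I] exI[of _ J]) auto
      next
        case 4
        have hyp: "m \<le> r X + s X + int (card (?E - X))" if "X \<subseteq> ?E" for X
          using 4(1)[unfolded first_def, THEN spec, THEN mp, OF that] r.rank_insert_loop[OF e 4(2) that] by simp
        then have "\<exists>I J. I \<subseteq> ?E \<and> J \<subseteq> ?E \<and> I \<inter> J = {} \<and> r I = int (card I)
            \<and> s J = int (card J) \<and> m \<le> int (card I) + int (card J)"
          by (intro psubset.IH[where r = r and s = s and m = m, OF sub r.rank_function_subset[OF Diff_subset] s.rank_function_subset[OF Diff_subset]])
        then obtain I J where "I \<subseteq> ?E" "J \<subseteq> ?E" "I \<inter> J = {}" "r I = int (card I)"
          "s J = int (card J)" "m \<le> int (card I) + int (card J)" by (elim exE conjE)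
        then show ?thesis by (intro exI[of _ I] exI[of _ J]) auto
      next
        case 5
        have hyp: "m \<le> r X + s X + int (card (?E - X))" if "X \<subseteq> ?E" for X
          using 5(1)[unfolded second_def, THEN spec, THEN mp, OF that] s.rank_insert_loop[OF e 5(3) that] by simp
        then have "\<exists>I J. I \<subseteq> ?E \<and> J \<subseteq> ?E \<and> I \<inter> J = {} \<and> r I = int (card I)
            \<and> s J = int (card J) \<and> m \<le> int (card I) + int (card J)"
          by (intro psubset.IH[where r = r and s = s and m = m, OF sub r.rank_function_subset[OF Diff_subset] s.rank_function_subset[OF Diff_subset]])
        then obtain I J where "I \<subseteq> ?E" "J \<subseteq> ?E" "I \<inter> J = {}" "r I = int (card I)"
          "s J = int (card J)" "m \<le> int (card I) + int (card J)" by (elim exE conjE)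
        then show ?thesis by (intro exI[of _ I] exI[of _ J]) auto
      qed
    qed
  qed
qed

section \<open>Components and the graphic rank\<close>

definition conn :: "('v, 'e) pre_digraph \<Rightarrow> 'e set \<Rightarrow> ('v \<times> 'v) set" where
  "conn D X = {(u, v). \<exists>e\<in>X. {u, v} = {tail D e, head D e}}\<^sup>*"

lemma conn_refl [simp]: "(u, u) \<in> conn D X"
  by (simp add: conn_def)

lemma conn_sym: "(u, v) \<in> conn D X \<Longrightarrow> (v, u) \<in> conn D X"
proof -
  have "sym {(u, v). \<exists>e\<in>X. {u, v} = {tail D e, head D e}}"
    by (auto simp: sym_def insert_commute)
  then show "(u, v) \<in> conn D X \<Longrightarrow> (v, u) \<in> conn D X"
    unfolding conn_def by (meson sym_rtrancl symD)
qed

lemma conn_trans: "(u, v) \<in> conn D X \<Longrightarrow> (v, w) \<in> conn D X \<Longrightarrow> (u, w) \<in> conn D X"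
  unfolding conn_def by (rule rtrancl_trans)

lemma conn_mono: "X \<subseteq> Y \<Longrightarrow> conn D X \<subseteq> conn D Y"
  unfolding conn_def by (rule rtrancl_mono) blast

lemma conn_arc: "e \<in> X \<Longrightarrow> (tail D e, head D e) \<in> conn D X"
  unfolding conn_def by (rule r_into_rtrancl) blast

lemma conn_closed:
  assumes "(u, v) \<in> conn D X" "u \<in> S" "\<And>e. e \<in> X \<Longrightarrow> tail D e \<in> S \<longleftrightarrow> head D e \<in> S"
  shows "v \<in> S"
  using assms(1) unfolding conn_def
proof induction
  case (step y z)
  then show ?case using assms(3) by (auto simp: doubleton_eq_iff)
qed (use assms in simp)

lemma conn_leI:
  assumes "\<And>e. e \<in> Y \<Longrightarrow> (tail D e, head D e) \<in> conn D X"
  shows "conn D Y \<subseteq> conn D X"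
proof clarify
  fix u v assume uv: "(u, v) \<in> conn D Y"
  have "v \<in> {v. (u, v) \<in> conn D X}"
    using uv
  proof (rule conn_closed)
    fix e assume "e \<in> Y"
    then have "(tail D e, head D e) \<in> conn D X" by (rule assms)
    then show "tail D e \<in> {v. (u, v) \<in> conn D X} \<longleftrightarrow> head D e \<in> {v. (u, v) \<in> conn D X}"
      by (auto intro: conn_trans conn_trans[OF _ conn_sym])
  qed simp
  then show "(u, v) \<in> conn D X" by simp
qed

definition components :: "('v, 'e) pre_digraph \<Rightarrow> 'e set \<Rightarrow> 'v set set" where
  "components D X = (\<lambda>v. verts D \<inter> conn D X `` {v}) ` verts D"

definition graph_rank :: "('v, 'e) pre_digraph \<Rightarrow> 'e set \<Rightarrow> int" where
  "graph_rank D X = int (card (verts D)) - int (card (components D X))"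

context fin_digraph
begin

lemma components_eqI:
  "C \<in> components G X \<Longrightarrow> u \<in> C \<Longrightarrow> C = verts G \<inter> conn G X `` {u}"
  by (auto simp: components_def intro: conn_trans conn_sym)

lemma component_of: "v \<in> verts G \<Longrightarrow> verts G \<inter> conn G X `` {v} \<in> components G X"
  by (auto simp: components_def)

lemma finite_components: "finite (components G X)"
  by (simp add: components_def)

lemma conn_insert_redundant:
  assumes "(tail G e, head G e) \<in> conn G X"
  shows "conn G (insert e X) = conn G X"
proof
  show "conn G (insert e X) \<subseteq> conn G X"
    using assms by (intro conn_leI) (auto intro: conn_arc)
qed (auto intro: conn_mono[THEN subsetD])

text \<open>
  The components of the two ends merge, and all others stay as they are.
\<close>

lemma card_components_insert:
  assumes e: "e \<in> arcs G" and nc: "(tail G e, head G e) \<notin> conn G X"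
  shows "card (components G X) = card (components G (insert e X)) + 1"
proof -
  let ?a = "tail G e" and ?b = "head G e"
  let ?C = "\<lambda>v. verts G \<inter> conn G X `` {v}"
  let ?C' = "\<lambda>v. verts G \<inter> conn G (insert e X) `` {v}"
  let ?U = "?C ?a \<union> ?C ?b"
  have ab: "?a \<in> verts G" "?b \<in> verts G" using e by auto
  have m: "(u, v) \<in> conn G X \<Longrightarrow> (u, v) \<in> conn G (insert e X)" for u v
    using conn_mono[of X "insert e X"] by auto
  have ea: "(?a, ?b) \<in> conn G (insert e X)" by (rule conn_arc) simp
  have far: "?C' v = ?C v" if v: "v \<in> verts G" "v \<notin> ?U" for v
  proof -
    have "w \<in> ?C v" if "w \<in> verts G" "(v, w) \<in> conn G (insert e X)" for w
    proof -
      have "w \<in> {w. (v, w) \<in> conn G X}"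
        using that(2)
      proof (rule conn_closed)
        fix x assume x: "x \<in> insert e X"
        show "tail G x \<in> {w. (v, w) \<in> conn G X} \<longleftrightarrow> head G x \<in> {w. (v, w) \<in> conn G X}"
        proof (cases "x = e")
          case True
          then show ?thesis using v by (auto dest: conn_sym)
        next
          case False
          with x have "(tail G x, head G x) \<in> conn G X" by (auto intro: conn_arc)
          then show ?thesis by (auto intro: conn_trans conn_sym)
        qed
      qed simp
      with that show ?thesis by simp
    qed
    then show ?thesis using m by auto
  qed
  have near: "?C' v = ?U" if v: "v \<in> ?U" for v
  proof -
    have "w \<in> ?U" if "w \<in> verts G" "(v, w) \<in> conn G (insert e X)" for w
    proof -
      have "w \<in> conn G X `` {?a} \<union> conn G X `` {?b}"
        using that(2)
      proof (rule conn_closed)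
        fix x assume x: "x \<in> insert e X"
        show "tail G x \<in> conn G X `` {?a} \<union> conn G X `` {?b}
            \<longleftrightarrow> head G x \<in> conn G X `` {?a} \<union> conn G X `` {?b}"
        proof (cases "x = e")
          case False
          with x have "(tail G x, head G x) \<in> conn G X" by (auto intro: conn_arc)
          then show ?thesis by (auto intro: conn_trans conn_sym)
        qed auto
      qed (use v in auto)
      with that show ?thesis by auto
    qed
    moreover have "(v, w) \<in> conn G (insert e X)" if "w \<in> ?U" for w
    proof -
      have "(?a, u) \<in> conn G (insert e X)" if "u \<in> ?U" for u
        using that m ea by (auto intro: conn_trans)
      then show ?thesis using that v by (blast intro: conn_trans conn_sym)
    qed
    ultimately show ?thesis by auto
  qed
  let ?R = "?C ` (verts G - ?U)"
  have split: "verts G = (verts G - ?U) \<union> (verts G \<inter> ?U)" by auto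
  have "components G (insert e X) = ?C' ` (verts G - ?U) \<union> ?C' ` (verts G \<inter> ?U)"
    unfolding components_def by (subst split) (rule image_Un)
  also have "?C' ` (verts G - ?U) = ?R" by (rule image_cong[OF refl]) (rule far, auto)
  also have "?C' ` (verts G \<inter> ?U) = (\<lambda>_. ?U) ` (verts G \<inter> ?U)"
    by (rule image_cong[OF refl]) (rule near, blast)
  also have "\<dots> = {?U}" using ab by auto
  finally have 1: "components G (insert e X) = insert ?U ?R" by auto
  have "?C v \<in> {?C ?a, ?C ?b}" if "v \<in> ?U" for v
    using that by (auto intro: conn_trans conn_sym)
  then have "?C ` (verts G \<inter> ?U) = {?C ?a, ?C ?b}" using ab by auto
  then have 2: "components G X = insert (?C ?a) (insert (?C ?b) ?R)"
    unfolding components_def by (subst split) (simp only: image_Un, auto)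
  have "?a \<in> ?C ?a" "?b \<in> ?C ?b" using ab by auto
  moreover have "?b \<notin> ?C ?a" using nc by auto
  moreover have "?a \<notin> Z \<and> ?b \<notin> Z" if "Z \<in> ?R" for Z
    using that by (auto dest: conn_sym)
  ultimately have "?C ?a \<noteq> ?C ?b" "?C ?a \<notin> ?R" "?C ?b \<notin> ?R" "?U \<notin> ?R" by blast+
  then show ?thesis unfolding 1 2 by simp
qed

lemma graph_rank_insert:
  assumes "e \<in> arcs G"
  shows "graph_rank G (insert e X) = graph_rank G X + (if (tail G e, head G e) \<in> conn G X then 0 else 1)"
  using card_components_insert[OF assms, of X] conn_insert_redundant[of e X]
  by (auto simp: graph_rank_def components_def)

lemma graph_rank_empty: "graph_rank G {} = 0"
proof -
  have "conn G {} = Id" by (simp add: conn_def)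
  then have "components G {} = (\<lambda>v. {v}) ` verts G"
    unfolding components_def by (intro image_cong) auto
  then show ?thesis by (simp add: graph_rank_def card_image)
qed

lemma graph_rank_mono:
  assumes "X \<subseteq> Y" "Y \<subseteq> arcs G"
  shows "graph_rank G X \<le> graph_rank G Y"
proof -
  have fin: "finite (Y - X)" using assms finite_subset[OF _ finite_arcs] by blast
  have "graph_rank G X \<le> graph_rank G (X \<union> Z)" if "Z \<subseteq> Y - X" for Z
    using finite_subset[OF that fin] that
  proof (induction Z rule: finite_induct)
    case (insert x Z)
    then show ?case using graph_rank_insert[of x "X \<union> Z"] assms by (auto split: if_splits)
  qed simp
  from this[of "Y - X"] show ?thesis using assms by (simp add: Un_absorb1)
qed

text \<open>
  An arc whose ends are connected by \<open>X \<inter> Y\<close> together with \<open>Z\<close> has its ends connected by \<open>Y\<close> together with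
  \<open>Z\<close>, so adding the arcs of \<open>X - Y\<close> one at a time increases the rank over \<open>Y\<close> no faster than over \<open>X \<inter> Y\<close>.
\<close>

lemma graph_rank_submodular:
  assumes "X \<subseteq> arcs G" "Y \<subseteq> arcs G"
  shows "graph_rank G (X \<union> Y) + graph_rank G (X \<inter> Y) \<le> graph_rank G X + graph_rank G Y"
proof -
  have "graph_rank G (Y \<union> Z) - graph_rank G Y \<le> graph_rank G ((X \<inter> Y) \<union> Z) - graph_rank G (X \<inter> Y)"
    if "Z \<subseteq> X - Y" for Z
    using finite_subset[OF subset_trans[OF that subset_trans[OF Diff_subset assms(1)]] finite_arcs] that
  proof (induction Z rule: finite_induct)
    case (insert x Z)
    then have "x \<in> arcs G" using assms(1) by auto
    then have x: "graph_rank G (insert x (Y \<union> Z)) = graph_rank G (Y \<union> Z) + (if (tail G x, head G x) \<in> conn G (Y \<union> Z) then 0 else 1)"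
      "graph_rank G (insert x ((X \<inter> Y) \<union> Z)) = graph_rank G ((X \<inter> Y) \<union> Z) + (if (tail G x, head G x) \<in> conn G ((X \<inter> Y) \<union> Z) then 0 else 1)"
      by (rule graph_rank_insert)+
    have "conn G ((X \<inter> Y) \<union> Z) \<subseteq> conn G (Y \<union> Z)" by (rule conn_mono) auto
    then show ?case
      using insert.IH insert.prems x by (auto split: if_splits)
  qed auto
  from this[of "X - Y"] have "graph_rank G (Y \<union> (X - Y)) - graph_rank G Y
      \<le> graph_rank G ((X \<inter> Y) \<union> (X - Y)) - graph_rank G (X \<inter> Y)" by simp
  moreover have "Y \<union> (X - Y) = X \<union> Y" "(X \<inter> Y) \<union> (X - Y) = X" by auto
  ultimately show ?thesis by simp
qed

lemma rank_function_graph_rank: "E \<subseteq> arcs G \<Longrightarrow> rank_function E (graph_rank G)"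
proof
  fix e assume "E \<subseteq> arcs G" "e \<in> E"
  then show "graph_rank G {e} \<le> 1"
    using graph_rank_insert[of e "{}"] graph_rank_empty by (auto split: if_splits)
qed (auto simp: graph_rank_empty intro: graph_rank_mono graph_rank_submodular finite_subset)

lemma graph_rank_eq_imp_conn:
  assumes "X \<subseteq> arcs G" "graph_rank G X = graph_rank G (arcs G)" "e \<in> arcs G"
  shows "(tail G e, head G e) \<in> conn G X"
  using graph_rank_insert[OF assms(3), of X] graph_rank_mono[of "insert e X" "arcs G"] assms
  by (auto split: if_splits)

lemma rank_augment:
  assumes "X \<subseteq> Z" "Z \<subseteq> arcs G"
  obtains Y where "Y \<subseteq> Z" "int (card Y) \<le> graph_rank G Z - graph_rank G X"
    "\<And>e. e \<in> Z \<Longrightarrow> (tail G e, head G e) \<in> conn G (X \<union> Y)"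
proof -
  have "\<exists>Y\<subseteq>Z. int (card Y) \<le> graph_rank G Z - graph_rank G X
      \<and> (\<forall>e\<in>Z. (tail G e, head G e) \<in> conn G (X \<union> Y))"
    using assms
  proof (induction "nat (graph_rank G Z - graph_rank G X)" arbitrary: X rule: less_induct)
    case less
    show ?case
    proof (cases "\<forall>e\<in>Z. (tail G e, head G e) \<in> conn G X")
      case True
      then show ?thesis using graph_rank_mono[OF less.prems] by (intro exI[of _ "{}"]) auto
    next
      case False
      then obtain e where e: "e \<in> Z" "(tail G e, head G e) \<notin> conn G X" by blast
      then have r: "graph_rank G (insert e X) = graph_rank G X + 1"
        using graph_rank_insert[of e X] less.prems by auto
      moreover have "graph_rank G (insert e X) \<le> graph_rank G Z"
        using e less.prems by (intro graph_rank_mono) auto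
      ultimately have "\<exists>Y\<subseteq>Z. int (card Y) \<le> graph_rank G Z - graph_rank G (insert e X)
          \<and> (\<forall>x\<in>Z. (tail G x, head G x) \<in> conn G (insert e X \<union> Y))"
        using e less.prems by (intro less.hyps) auto
      then obtain Y where Y: "Y \<subseteq> Z" "int (card Y) \<le> graph_rank G Z - graph_rank G (insert e X)"
        "\<forall>x\<in>Z. (tail G x, head G x) \<in> conn G (insert e X \<union> Y)" by blast
      have "finite Y" by (rule finite_subset[OF subset_trans[OF Y(1) less.prems(2)] finite_arcs])
      then have c: "card (insert e Y) \<le> card Y + 1" by (simp add: card_insert_if)
      have eq: "insert e X \<union> Y = X \<union> insert e Y" by auto
      show ?thesis
      proof (intro exI[of _ "insert e Y"] conjI)
        show "insert e Y \<subseteq> Z" using Y(1) e(1) by simp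
        show "int (card (insert e Y)) \<le> graph_rank G Z - graph_rank G X" using Y(2) r c by linarith
        show "\<forall>x\<in>Z. (tail G x, head G x) \<in> conn G (X \<union> insert e Y)" using Y(3) unfolding eq .
      qed
    qed
  qed
  then show ?thesis using that by blast
qed

lemma graph_rank_le_card: "X \<subseteq> arcs G \<Longrightarrow> graph_rank G X \<le> int (card X)"
proof -
  assume X: "X \<subseteq> arcs G"
  then have "finite X" by (rule finite_subset) simp
  then show ?thesis using X
  proof (induction X rule: finite_induct)
    case empty
    then show ?case using graph_rank_empty by simp
  next
    case (insert x F)
    then show ?case using graph_rank_insert[of x F] by (auto split: if_splits)
  qed
qed

section \<open>Two disjoint spanning sets of arcs\<close>

text \<open>
  The hypothesis of matroid union. Let \<open>\<S>\<close> be the set of components of \<open>X\<close> with a nonempty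
  cut. As cuts are even and none has two arcs, each of these cuts has at least four, and an arc lies
  in at most two of them, so
  \<open>2 |\<S>| \<le> |arcs G - X|\<close>. The other components of \<open>X\<close> are components of the whole digraph, which has at
  least one further component; this is where the additional \<open>2\<close> comes from.
\<close>

lemma graph_rank_deficit_le:
  assumes ev: "even_digraph G" and no2: "\<And>S. card (cut G S) \<noteq> 2"
    and X: "X \<subseteq> arcs G" "graph_rank G X \<noteq> graph_rank G (arcs G)"
  shows "2 * (graph_rank G (arcs G) - graph_rank G X) + 2 \<le> int (card (arcs G - X))"
proof -
  have "\<exists>e\<in>arcs G. (tail G e, head G e) \<notin> conn G X"
  proof (rule ccontr)
    assume "\<not> ?thesis"
    then have "conn G (arcs G) \<subseteq> conn G X" by (intro conn_leI) auto
    then have "conn G (arcs G) = conn G X" using conn_mono[OF X(1)] by blast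
    then show False using X(2) by (simp add: graph_rank_def components_def)
  qed
  then obtain d where d: "d \<in> arcs G" "(tail G d, head G d) \<notin> conn G X" by blast
  let ?comp = "\<lambda>Y v. verts G \<inter> conn G Y `` {v}"
  define \<S> where "\<S> = {C \<in> components G X. cut G C \<noteq> {}}"
  have fin: "finite \<S>" using finite_components by (simp add: \<S>_def)
  have cut_sub: "cut G C \<subseteq> arcs G - X" if "C \<in> components G X" for C
  proof -
    have "(tail G e \<in> C) = (head G e \<in> C)" if "e \<in> X" for e
    proof -
      have "(tail G e, head G e) \<in> conn G X" using that by (rule conn_arc)
      moreover obtain v where "C = ?comp X v" using \<open>C \<in> components G X\<close> by (auto simp: components_def)
      ultimately show ?thesis using that X(1) by (auto intro: conn_trans conn_trans[OF _ conn_sym])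
    qed
    then show ?thesis by (auto simp: cut_def)
  qed
  have four: "4 \<le> card (cut G C)" if "C \<in> \<S>" for C
  proof -
    have "even (card (cut G C))" by (rule even_card_cut[OF fin_digraph ev])
    moreover have "card (cut G C) \<noteq> 0" using that by (auto simp: \<S>_def cut_def)
    moreover have "card (cut G C) \<noteq> 2" by (rule no2)
    ultimately show ?thesis by presburger
  qed
  have "4 * card \<S> \<le> (\<Sum>C\<in>\<S>. card (cut G C))"
    using sum_mono[of \<S> "\<lambda>_. 4" "\<lambda>C. card (cut G C)"] four by simp
  also have "\<dots> = (\<Sum>C\<in>\<S>. card {e \<in> arcs G - X. e \<in> cut G C})"
    using cut_sub by (intro sum.cong refl arg_cong[where f = card]) (auto simp: \<S>_def)
  also have "\<dots> = (\<Sum>e\<in>arcs G - X. card {C \<in> \<S>. e \<in> cut G C})"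
    using fin by (intro sum_multicount_gen) auto
  also have "\<dots> \<le> (\<Sum>e\<in>arcs G - X. 2)"
  proof (rule sum_mono)
    fix e assume "e \<in> arcs G - X"
    have "{C \<in> \<S>. e \<in> cut G C} \<subseteq> {?comp X (tail G e), ?comp X (head G e)}"
      using components_eqI by (fastforce simp: \<S>_def cut_def)
    then have "card {C \<in> \<S>. e \<in> cut G C} \<le> card {?comp X (tail G e), ?comp X (head G e)}"
      by (intro card_mono) auto
    also have "\<dots> \<le> 2" by (simp add: card_insert_if)
    finally show "card {C \<in> \<S>. e \<in> cut G C} \<le> 2" .
  qed
  finally have S: "2 * card \<S> \<le> card (arcs G - X)" by simp
  let ?C = "?comp (arcs G) (tail G d)"
  have "?C \<in> components G (arcs G)" using d by (intro component_of) auto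
  moreover have "C \<in> components G (arcs G)" if C: "C \<in> components G X - \<S>" for C
  proof -
    obtain v where v: "v \<in> verts G" "C = ?comp X v" using C by (auto simp: components_def)
    have "cut G C = {}" using C by (auto simp: \<S>_def)
    then have cl: "tail G e \<in> C \<longleftrightarrow> head G e \<in> C" if "e \<in> arcs G" for e
      using that by (auto simp: cut_def)
    have "w \<in> C" if "(v, w) \<in> conn G (arcs G)" for w
      using that by (rule conn_closed) (use v cl in auto)
    then have "C = ?comp (arcs G) v" using v conn_mono[OF X(1)] by auto
    then show ?thesis using v by (auto simp: components_def)
  qed
  moreover have "?C \<notin> components G X"
  proof
    assume "?C \<in> components G X"
    then have "?C = ?comp X (tail G d)" by (rule components_eqI) (use d in auto)
    moreover have "head G d \<in> ?C" using d conn_arc by auto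
    ultimately show False using d by auto
  qed
  ultimately have "card (insert ?C (components G X - \<S>)) \<le> card (components G (arcs G))"
    by (intro card_mono finite_components) auto
  moreover have "card (insert ?C (components G X - \<S>)) = card (components G X - \<S>) + 1"
    using finite_components \<open>?C \<notin> components G X\<close> by simp
  moreover have "card (components G X) \<le> card (components G X - \<S>) + card \<S>"
  proof -
    have "components G X = (components G X - \<S>) \<union> \<S>" by (auto simp: \<S>_def)
    then show ?thesis using card_Un_le[of "components G X - \<S>" \<S>] by simp
  qed
  ultimately show ?thesis using S by (simp add: graph_rank_def)
qed

text \<open>
  The additional \<open>2\<close> in the previous bound pays for the removal of the arcs in \<open>F\<close>.
\<close>

lemma two_disjoint_spanning:
  assumes ev: "even_digraph G" and no2: "\<And>S. card (cut G S) \<noteq> 2" and F: "card F \<le> 2" "finite F"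
  obtains I J where "I \<subseteq> arcs G - F" "J \<subseteq> arcs G - F" "I \<inter> J = {}"
    "graph_rank G I = graph_rank G (arcs G)" "graph_rank G J = graph_rank G (arcs G)"
proof -
  let ?E = "arcs G - F" and ?r = "graph_rank G"
  have r: "rank_function ?E ?r" by (rule rank_function_graph_rank) auto
  have "2 * ?r (arcs G) \<le> ?r X + ?r X + int (card (?E - X))" if X: "X \<subseteq> ?E" for X
  proof (cases "?r X = ?r (arcs G)")
    case False
    then have "2 * (?r (arcs G) - ?r X) + 2 \<le> int (card (arcs G - X))"
      using X by (intro graph_rank_deficit_le[OF ev no2]) auto
    moreover have "card (arcs G - X) \<le> card (?E - X) + card F"
    proof -
      have "card (arcs G - X) \<le> card ((?E - X) \<union> F)" using F by (intro card_mono) auto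
      then show ?thesis using card_Un_le[of "?E - X" F] by linarith
    qed
    then have "int (card (arcs G - X)) \<le> int (card (?E - X)) + 2" using F by linarith
    ultimately have "2 * ?r (arcs G) + 2 \<le> 2 * ?r X + (int (card (?E - X)) + 2)"
      by (simp add: right_diff_distrib)
    then show ?thesis by simp
  qed simp
  then have "\<exists>I J. I \<subseteq> ?E \<and> J \<subseteq> ?E \<and> I \<inter> J = {} \<and> ?r I = int (card I) \<and> ?r J = int (card J)
      \<and> 2 * ?r (arcs G) \<le> int (card I) + int (card J)"
    by (rule matroid_union[OF r r])
  then obtain I J where IJ: "I \<subseteq> ?E" "J \<subseteq> ?E" "I \<inter> J = {}" "?r I = int (card I)" "?r J = int (card J)"
      "2 * ?r (arcs G) \<le> int (card I) + int (card J)" by (elim exE conjE)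
  moreover have "?r I \<le> ?r (arcs G)" "?r J \<le> ?r (arcs G)"
    using IJ(1,2) by (blast intro: graph_rank_mono)+
  ultimately show ?thesis by (intro that[of I J]) auto
qed

section \<open>Prescribing the support of a circulation\<close>

lemma net_out_single:
  "e \<in> arcs G \<Longrightarrow> net_out G (\<lambda>x. if x = e then c else 0) S
    = (if tail G e \<in> S then c else 0) - (if head G e \<in> S then c else 0)"
proof -
  assume e: "e \<in> arcs G"
  have "net_out G (\<lambda>x. if x = e then c else 0) S = (\<Sum>x\<in>arcs G. if x = e then
      (if tail G e \<in> S then c else 0) - (if head G e \<in> S then c else 0) else 0)"
    unfolding net_out_def by (rule sum.cong) auto
  then show ?thesis using e by simp
qed

lemma conn_imp_flow:
  assumes "(u, v) \<in> conn G X" "X \<subseteq> arcs G"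
  shows "\<exists>g :: 'b \<Rightarrow> int. (\<forall>e. e \<notin> X \<longrightarrow> g e = 0) \<and>
    (\<forall>S. net_out G g S = of_bool (u \<in> S) - of_bool (v \<in> S))"
  using assms(1) unfolding conn_def
proof induction
  case base
  show ?case by (intro exI[of _ "\<lambda>_. 0"]) (auto simp: net_out_def)
next
  case (step y z)
  then obtain g :: "'b \<Rightarrow> int" where g: "\<forall>e. e \<notin> X \<longrightarrow> g e = 0"
    "\<forall>S. net_out G g S = of_bool (u \<in> S) - of_bool (y \<in> S)" by blast
  from step obtain e where e: "e \<in> X" "{y, z} = {tail G e, head G e}" by blast
  define c :: int where "c = (if y = tail G e then 1 else - 1)"
  have "net_out G (\<lambda>x. g x + (if x = e then c else 0)) S = of_bool (u \<in> S) - of_bool (z \<in> S)" for S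
  proof -
    have "net_out G (\<lambda>x. if x = e then c else 0) S = of_bool (y \<in> S) - of_bool (z \<in> S)"
      using e assms(2) by (subst net_out_single) (auto simp: c_def doubleton_eq_iff)
    then show ?thesis using g(2) by (simp add: net_out_add)
  qed
  then show ?case using g(1) e by (intro exI[of _ "\<lambda>x. g x + (if x = e then c else 0)"]) auto
qed

lemma fundamental_circulation:
  assumes "T \<subseteq> arcs G" "e \<in> arcs G" "(tail G e, head G e) \<in> conn G T"
  obtains g :: "'b \<Rightarrow> int" where "circulation G g" "\<And>x. x \<notin> T \<Longrightarrow> g x = (if x = e then 1 else 0)"
proof -
  obtain g :: "'b \<Rightarrow> int" where g: "\<And>x. x \<notin> T \<Longrightarrow> g x = 0"
    "\<And>S. net_out G g S = of_bool (head G e \<in> S) - of_bool (tail G e \<in> S)"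
    using conn_imp_flow[OF conn_sym[OF assms(3)] assms(1)] by blast
  show ?thesis
  proof (rule that[of "\<lambda>x. g x + (if x = e then 1 else 0)"])
    show "circulation G (\<lambda>x. g x + (if x = e then 1 else 0))"
      using g(2) net_out_single[OF assms(2), where c = "1 :: int"] by (simp add: circulation_def net_out_add)
  qed (use g(1) in auto)
qed

text \<open>
  The sum of the fundamental circulations of the arcs in \<open>W\<close> is \<open>1\<close> on \<open>W\<close> and \<open>0\<close> elsewhere outside \<open>T\<close>.
  It may be large on \<open>T\<close>; reduction modulo 2 brings all values into \<open>{-1, 0, 1}\<close>, keeping the support
  outside \<open>T\<close>.
\<close>

lemma cotree_prescription:
  assumes "T \<subseteq> Z" "Z \<subseteq> arcs G" "\<And>e. e \<in> Z \<Longrightarrow> (tail G e, head G e) \<in> conn G T" "W \<subseteq> Z - T"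
  obtains k :: "'b \<Rightarrow> int" where "circulation G k" "\<And>e. \<bar>k e\<bar> \<le> 1"
    "\<And>e. e \<in> arcs G - Z \<Longrightarrow> k e = 0" "\<And>e. e \<in> Z - T \<Longrightarrow> k e \<noteq> 0 \<longleftrightarrow> e \<in> W"
proof -
  have fin: "finite W" using assms(2,4) finite_subset[OF _ finite_arcs, of W] by auto
  have "\<forall>e\<in>W. \<exists>g :: 'b \<Rightarrow> int. circulation G g \<and> (\<forall>x. x \<notin> T \<longrightarrow> g x = (if x = e then 1 else 0))"
  proof
    fix e assume "e \<in> W"
    then have e: "e \<in> Z" using assms(4) by auto
    obtain g :: "'b \<Rightarrow> int" where "circulation G g" "\<And>x. x \<notin> T \<Longrightarrow> g x = (if x = e then 1 else 0)"
      using fundamental_circulation[OF subset_trans[OF assms(1,2)] subsetD[OF assms(2) e] assms(3)[OF e]]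
      by metis
    then show "\<exists>g :: 'b \<Rightarrow> int. circulation G g \<and> (\<forall>x. x \<notin> T \<longrightarrow> g x = (if x = e then 1 else 0))"
      by metis
  qed
  then obtain g :: "'b \<Rightarrow> 'b \<Rightarrow> int" where g: "\<And>e. e \<in> W \<Longrightarrow> circulation G (g e)"
    "\<And>e x. e \<in> W \<Longrightarrow> x \<notin> T \<Longrightarrow> g e x = (if x = e then 1 else 0)" by metis
  let ?h = "\<lambda>x. \<Sum>e\<in>W. g e x"
  have h: "?h x = (if x \<in> W then 1 else 0)" if "x \<notin> T" for x
  proof -
    have "?h x = (\<Sum>e\<in>W. if x = e then 1 else 0)" using g(2) that by (intro sum.cong) auto
    then show ?thesis using fin by simp
  qed
  have "circulation G ?h" by (rule circulation_sum) (rule g(1))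
  then obtain k :: "'b \<Rightarrow> int" where k: "circulation G k" "\<And>e. \<bar>k e\<bar> \<le> 1"
    "\<And>e. e \<in> arcs G \<Longrightarrow> k e \<noteq> 0 \<longleftrightarrow> odd (?h e)"
    using circulation_mod_2[OF fin_digraph] by blast
  show ?thesis
  proof (rule that[OF k(1,2)])
    fix e assume "e \<in> arcs G - Z"
    then have "e \<notin> T" "e \<notin> W" "e \<in> arcs G" using assms(1,4) by auto
    then show "k e = 0" using k(3)[of e] h[of e] by simp
  next
    fix e assume "e \<in> Z - T"
    then have "e \<notin> T" "e \<in> arcs G" using assms(2) by auto
    then show "k e \<noteq> 0 \<longleftrightarrow> e \<in> W" using k(3)[of e] h[of e] by simp
  qed
qed

end

section \<open>Nowhere-zero circulations and shifts\<close>

definition nz_circulation :: "('v, 'e) pre_digraph \<Rightarrow> ('e \<Rightarrow> 'a::ab_group_add) \<Rightarrow> bool" where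
  "nz_circulation D f \<longleftrightarrow> circulation D f \<and> (\<forall>e\<in>arcs D. f e \<noteq> 0)"

text \<open>
  Values off the arc set are irrelevant, so that functions can be carried over between digraphs with
  different arc sets.
\<close>

definition shift :: "('v, 'e) pre_digraph \<Rightarrow> ('e \<Rightarrow> 'a::ab_group_add) \<Rightarrow> ('e \<Rightarrow> 'a) \<Rightarrow> bool" where
  "shift D f g \<longleftrightarrow> nz_circulation D f \<and> nz_circulation D g \<and>
     (\<exists>(k :: 'e \<Rightarrow> int) z. circulation D k \<and> (\<forall>e\<in>arcs D. \<bar>k e\<bar> \<le> 1 \<and> g e = f e + zmul (k e) z))"

lemma shiftI:
  assumes "nz_circulation D f" "circulation D (k :: 'e \<Rightarrow> int)"
    "\<And>e. e \<in> arcs D \<Longrightarrow> \<bar>k e\<bar> \<le> 1" "\<And>e. e \<in> arcs D \<Longrightarrow> g e = f e + zmul (k e) z"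
    "\<And>e. e \<in> arcs D \<Longrightarrow> g e \<noteq> 0"
  shows "shift D f g"
proof -
  have "circulation D (\<lambda>e. f e + zmul (k e) z)"
    using assms by (intro circulation_add circulation_zmul) (auto simp: nz_circulation_def)
  then have "circulation D g" using assms(4) by (subst circulation_cong) auto
  then show ?thesis using assms unfolding shift_def nz_circulation_def by blast
qed

lemma shift_sym: "shift D f g \<Longrightarrow> shift D g f"
proof -
  assume "shift D f g"
  then obtain k z where k: "nz_circulation D f" "nz_circulation D g" "circulation D k"
    "\<forall>e\<in>arcs D. \<bar>k e\<bar> \<le> 1 \<and> g e = f e + zmul (k e) z" by (auto simp: shift_def)
  then show "shift D g f"
    by (intro shiftI[of _ _ "\<lambda>e. - k e" _ z] circulation_minus) (auto simp: nz_circulation_def)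
qed

lemma shifts_sym: "(shift D)\<^sup>*\<^sup>* f g \<Longrightarrow> (shift D)\<^sup>*\<^sup>* g f"
  by (induction rule: rtranclp_induct) (auto intro: converse_rtranclp_into_rtranclp shift_sym)

lemma shifts_transfer:
  assumes "\<And>f g. shift D' f g \<Longrightarrow> shift D (L f) (L g)" "(shift D')\<^sup>*\<^sup>* f g"
  shows "(shift D)\<^sup>*\<^sup>* (L f) (L g)"
  using assms(2) by induction (auto intro: rtranclp.rtrancl_into_rtrancl assms(1))

lemma shifts_nz_circulation: "(shift D)\<^sup>*\<^sup>* f g \<Longrightarrow> nz_circulation D f \<Longrightarrow> nz_circulation D g"
  by (induction rule: rtranclp_induct) (auto simp: shift_def)

text \<open>
  The arcs \<open>R\<close> with value \<open>\<plusminus>z\<close> must not be changed, as the sign of the change is not under control.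
  Removing \<open>R\<close> from the spanning set \<open>T\<close> is repaired by a set \<open>Y\<close> of at most \<open>|T \<inter> R|\<close> other arcs. The
  prescription then fails only on \<open>Y\<close> and on \<open>R - T\<close>, together at most \<open>|R|\<close> arcs.
\<close>

lemma (in fin_digraph) shift_along_cotree:
  fixes f :: "'b \<Rightarrow> 'c::ab_group_add"
  assumes f: "nz_circulation G f" and T: "T \<subseteq> arcs G" "graph_rank G T = graph_rank G (arcs G)"
    and W: "W \<subseteq> arcs G - T"
  obtains g X where "shift G f g" "X \<subseteq> arcs G" "card X \<le> card {e \<in> arcs G. f e \<in> {z, - z}}"
    "\<And>e. e \<in> arcs G \<Longrightarrow> g e \<in> {f e, f e + z, f e - z}"
    "\<And>e. e \<in> W - X \<Longrightarrow> g e \<in> {f e + z, f e - z}"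
    "\<And>e. e \<in> arcs G - T - W - X \<Longrightarrow> g e = f e"
proof -
  define R where "R = {e \<in> arcs G. f e \<in> {z, - z}}"
  have R: "R \<subseteq> arcs G" "finite R" by (auto simp: R_def)
  obtain Y where Y: "Y \<subseteq> arcs G - R"
      "int (card Y) \<le> graph_rank G (arcs G - R) - graph_rank G (T - R)"
      "\<And>e. e \<in> arcs G - R \<Longrightarrow> (tail G e, head G e) \<in> conn G ((T - R) \<union> Y)"
    using rank_augment[of "T - R" "arcs G - R"] T(1) by blast
  have "card Y \<le> card (T \<inter> R)"
  proof -
    have "graph_rank G ((T - R) \<union> (T \<inter> R)) + graph_rank G ((T - R) \<inter> (T \<inter> R))
        \<le> graph_rank G (T - R) + graph_rank G (T \<inter> R)"
      using T(1) by (intro graph_rank_submodular) auto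
    moreover have "(T - R) \<union> (T \<inter> R) = T" "(T - R) \<inter> (T \<inter> R) = {}" by auto
    moreover have "graph_rank G (T \<inter> R) \<le> int (card (T \<inter> R))" using R by (intro graph_rank_le_card) auto
    moreover have "graph_rank G (arcs G - R) \<le> graph_rank G (arcs G)" by (intro graph_rank_mono) auto
    ultimately show ?thesis using Y(2) T(2) graph_rank_empty by auto
  qed
  moreover have "card (Y \<union> (R - T)) \<le> card Y + card (R - T)" by (rule card_Un_le)
  moreover have "card (R \<inter> T) + card (R - T) = card R"
    using card_Int_Diff[OF R(2), of T] by simp
  ultimately have X: "card (Y \<union> (R - T)) \<le> card R" by (simp add: Int_commute)
  have sub: "(T - R) \<union> Y \<subseteq> arcs G - R" using T Y by auto
  have W': "W \<inter> (arcs G - R - ((T - R) \<union> Y)) \<subseteq> arcs G - R - ((T - R) \<union> Y)" by auto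
  obtain k :: "'b \<Rightarrow> int" where k: "circulation G k" "\<And>e. \<bar>k e\<bar> \<le> 1"
    "\<And>e. e \<in> arcs G - (arcs G - R) \<Longrightarrow> k e = 0"
    "\<And>e. e \<in> arcs G - R - ((T - R) \<union> Y) \<Longrightarrow> k e \<noteq> 0 \<longleftrightarrow> e \<in> W \<inter> (arcs G - R - ((T - R) \<union> Y))"
    using cotree_prescription[OF sub Diff_subset Y(3) W'] by blast
  let ?g = "\<lambda>e. f e + zmul (k e) z"
  have k3: "zmul (k e) z = (if k e = 0 then 0 else if k e = 1 then z else - z)" for e
    by (rule zmul_unit_cases[OF k(2)])
  show ?thesis
  proof (rule that[of ?g "Y \<union> (R - T)"])
    show "shift G f ?g"
    proof (rule shiftI[OF f k(1,2) refl])
      fix e assume e: "e \<in> arcs G"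
      show "?g e \<noteq> 0"
      proof (cases "e \<in> R")
        case True
        then show ?thesis using k(3)[of e] e f by (auto simp: nz_circulation_def)
      next
        case False
        then have "f e \<noteq> z" "f e \<noteq> - z" using e by (auto simp: R_def)
        then show ?thesis using f e by (auto simp: k3 nz_circulation_def eq_neg_iff_add_eq_0)
      qed
    qed
    show "card (Y \<union> (R - T)) \<le> card {e \<in> arcs G. f e \<in> {z, - z}}" using X by (simp add: R_def)
    show "?g e \<in> {f e, f e + z, f e - z}" if "e \<in> arcs G" for e by (auto simp: k3)
    show "?g e \<in> {f e + z, f e - z}" if "e \<in> W - (Y \<union> (R - T))" for e
    proof -
      have "e \<in> W \<inter> (arcs G - R - ((T - R) \<union> Y))" using that W by auto
      then have "k e \<noteq> 0" using k(4)[of e] by auto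
      then show ?thesis by (auto simp: k3)
    qed
    show "?g e = f e" if "e \<in> arcs G - T - W - (Y \<union> (R - T))" for e
      using k(4)[of e] that by auto
  qed (use Y R in auto)
qed

section \<open>Generic pairs of group elements\<close>

text \<open>
  Up to sign, the differences that a set \<open>B\<close> must not contain for the following to hold: no two elements
  of \<open>B\<close> differ by \<open>q\<close>, and no two elements of the union of \<open>B\<close>, \<open>B + q\<close> and \<open>B - q\<close> differ by \<open>p\<close>.
\<close>

definition gap :: "'a::ab_group_add \<Rightarrow> 'a \<Rightarrow> 'a set" where
  "gap p q = {q, p, p + q, p - q, p + q + q, p - q - q}"

definition compatible :: "'a::ab_group_add set \<Rightarrow> 'a \<Rightarrow> 'a \<Rightarrow> bool" where
  "compatible B p q \<longleftrightarrow> (\<forall>a\<in>B. \<forall>b\<in>B. a - b \<notin> gap p q)"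

text \<open>
  If a flow avoids these values, then it can be shifted by \<open>p\<close> and afterwards by \<open>q\<close>, along any two
  circulations with values in \<open>{-1, 0, 1}\<close>, and stays nowhere zero.
\<close>

definition octet :: "'a::ab_group_add \<Rightarrow> 'a \<Rightarrow> 'a set" where
  "octet p q = {p, - p, q, - q, q + p, - (q + p), q - p, - (q - p)}"

lemma card_octet_le: "card (octet p q) \<le> 8"
  unfolding octet_def by (intro card_insert_le_m1) auto

text \<open>
  Greedy choice: first \<open>q\<close> outside the at most 576 differences of \<open>B\<close> and outside \<open>C\<close> and \<open>-C\<close>; then \<open>p\<close>
  outside five translates of the differences and six translates of \<open>C\<close> and \<open>-C\<close>, which is at most
  \<open>2880 + 144\<close> elements. Coincidences within an octet are permitted, because excluding the solutions of
  \<open>2 p = \<plusminus>q\<close> could exclude a large part of a group with many elements of order two.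
\<close>

lemma ex_compatible:
  fixes B C :: "'a::{ab_group_add, finite} set"
  assumes "card B \<le> 24" "card C \<le> 24" "4000 \<le> CARD('a)"
  shows "\<exists>p q. compatible B p q \<and> octet p q \<inter> C = {}"
proof -
  have BB: "card (B \<times> B) \<le> 24 * 24"
    unfolding card_cartesian_product using assms(1) by (intro mult_mono) auto
  have avoid: "\<exists>x. x \<notin> X" if "card X \<le> 3999" for X :: "'a set"
  proof (rule ccontr)
    assume "\<not> ?thesis"
    then have "X = UNIV" by auto
    with that assms(3) show False by simp
  qed
  let ?N = "(\<lambda>c. - c) ` C"
  have N: "card ?N \<le> 24" using card_image_le[of C uminus] assms(2) by simp
  let ?X = "(\<lambda>(a, b). a - b) ` (B \<times> B) \<union> (C \<union> ?N)"
  have "card ((\<lambda>(a, b). a - b) ` (B \<times> B)) \<le> 576"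
    using card_image_le[of "B \<times> B" "\<lambda>(a, b). a - b"] BB by simp
  then have "card ?X \<le> 576 + (24 + 24)"
    using card_Un_le[of "(\<lambda>(a, b). a - b) ` (B \<times> B)" "C \<union> ?N"] card_Un_le[of C ?N] N assms(2)
    by linarith
  then obtain q where q: "q \<notin> ?X" using avoid[of ?X] by auto
  let ?S = "{0, q, - q, q + q, - q - q}"
  let ?Y = "(\<lambda>((a, b), s). a - b + s) ` ((B \<times> B) \<times> ?S)"
  let ?C' = "C \<union> ?N \<union> ((\<lambda>c. c - q) ` C \<union> (\<lambda>c. - c - q) ` C \<union> ((\<lambda>c. q - c) ` C \<union> (\<lambda>c. q + c) ` C))"
  have "card ?S \<le> 5" by (intro card_insert_le_m1) auto
  then have "card ((B \<times> B) \<times> ?S) \<le> 576 * 5"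
    unfolding card_cartesian_product[of "B \<times> B"] using BB by (intro mult_mono) auto
  then have Y: "card ?Y \<le> 2880"
    using card_image_le[of "(B \<times> B) \<times> ?S" "\<lambda>((a, b), s). a - b + s"] by simp
  have im: "card (h ` C) \<le> 24" for h :: "'a \<Rightarrow> 'a"
    using card_image_le[of C h] assms(2) by simp
  have un: "card (U \<union> V) \<le> m + n" if "card U \<le> m" "card V \<le> n" for U V :: "'a set" and m n
    using card_Un_le[of U V] that by linarith
  have "card (?Y \<union> ?C') \<le> 2880 + ((24 + 24) + ((24 + 24) + (24 + 24)))"
    by (intro un Y im assms(2))
  then obtain p where p: "p \<notin> ?Y \<union> ?C'" using avoid[of "?Y \<union> ?C'"] by auto
  have gapS: "x = q \<or> (\<exists>s\<in>?S. p = x + s)" if "x \<in> gap p q" for x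
    using that by (auto simp: gap_def algebra_simps)
  have "a - b \<notin> gap p q" if ab: "a \<in> B" "b \<in> B" for a b
  proof
    assume "a - b \<in> gap p q"
    then consider "a - b = q" | s where "s \<in> ?S" "p = a - b + s" using gapS by blast
    then show False
    proof cases
      case 1
      then have "q \<in> ?X" using ab by force
      then show ?thesis using q by simp
    next
      case 2
      then have "((a, b), s) \<in> (B \<times> B) \<times> ?S" using ab by simp
      then have "p \<in> ?Y" using 2(2) by (intro image_eqI[of _ _ "((a, b), s)"]) auto
      then show ?thesis using p by simp
    qed
  qed
  moreover have "x \<notin> octet p q" if x: "x \<in> C" for x
  proof
    assume "x \<in> octet p q"
    then have "x = p \<or> x = - p \<or> x = q \<or> x = - q \<or> x = q + p \<or> x = - (q + p) \<or> x = q - p \<or> x = - (q - p)"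
      by (simp add: octet_def)
    then have "p = x \<or> p = - x \<or> q = x \<or> q = - x \<or> p = x - q \<or> p = - x - q \<or> p = q - x \<or> p = q + x"
      by (elim disjE) simp_all
    then have "q \<in> C \<union> ?N \<or> p \<in> ?C'" using x by auto
    then show False using p q by blast
  qed
  ultimately show ?thesis unfolding compatible_def by (intro exI[of _ p] exI[of _ q]) auto
qed

lemma compatible_separated:
  assumes "compatible B p q" "y \<in> B \<or> y + q \<in> B \<or> y - q \<in> B"
    "y + p \<in> B \<or> y + p + q \<in> B \<or> y + p - q \<in> B"
  shows False
proof -
  have *: "b - a \<notin> gap p q" if "a \<in> B" "b \<in> B" for a b
    using assms(1) that by (auto simp: compatible_def)
  show False
    using assms(2,3)
    by (elim disjE) (drule (1) *, simp add: gap_def algebra_simps)+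
qed

section \<open>Avoiding a set of values\<close>

context fin_digraph
begin

text \<open>
  Let \<open>B'\<close> be the set of values from which a change by \<open>0\<close>, \<open>q\<close> or \<open>-q\<close> leads into \<open>B\<close>. The shift by \<open>p\<close>
  changes exactly the arcs outside \<open>I\<close> with a value in \<open>B'\<close>, and by compatibility takes them out of \<open>B'\<close>.
  The shift by \<open>q\<close> does the same for \<open>B\<close> outside \<open>J\<close>. Its effect on \<open>J\<close> is arbitrary, but the arcs
  of \<open>J\<close> lie outside \<open>I\<close> and so have left \<open>B'\<close> before. Arcs in \<open>K\<close>, outside both sets, are left alone.
  All this holds up to the error sets of the two shifts. The arcs with value \<open>\<plusminus>q\<close> at the second shift had
  a value \<open>\<plusminus>q\<close> or \<open>\<plusminus>q \<plusminus> p\<close> before the first, so both error sets are bounded through the octet.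
\<close>

lemma shifts_avoiding_up_to:
  fixes f :: "'b \<Rightarrow> 'c::ab_group_add"
  assumes f: "nz_circulation G f"
    and I: "I \<subseteq> arcs G" "graph_rank G I = graph_rank G (arcs G)"
    and J: "J \<subseteq> arcs G" "graph_rank G J = graph_rank G (arcs G)"
    and IJ: "I \<inter> J = {}" and K: "K \<subseteq> arcs G - I - J"
    and compat: "compatible B p q"
  obtains g X where "(shift G)\<^sup>*\<^sup>* f g" "X \<subseteq> arcs G" "card X \<le> 2 * card {e \<in> arcs G. f e \<in> octet p q}"
    "\<And>e. e \<in> arcs G - K - X \<Longrightarrow> g e \<notin> B" "\<And>e. e \<in> K - X \<Longrightarrow> g e = f e"
proof -
  define B' where "B' = {y. y \<in> B \<or> y + q \<in> B \<or> y - q \<in> B}"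
  have sep': "y + p \<notin> B' \<and> y - p \<notin> B'" if "y \<in> B'" for y
    using compatible_separated[OF compat, of y] compatible_separated[OF compat, of "y - p"] that
    by (auto simp: B'_def)
  have sep: "y + q \<notin> B \<and> y - q \<notin> B" if "y \<in> B" for y
  proof -
    have "(y + q) - y \<in> gap p q" "y - (y - q) \<in> gap p q" by (auto simp: gap_def)
    then show ?thesis using compat that unfolding compatible_def by blast
  qed
  let ?W = "{e \<in> arcs G - I - K. f e \<in> B'}"
  obtain f' X where f': "shift G f f'" "X \<subseteq> arcs G" "card X \<le> card {e \<in> arcs G. f e \<in> {p, - p}}"
    "\<And>e. e \<in> arcs G \<Longrightarrow> f' e \<in> {f e, f e + p, f e - p}"
    "\<And>e. e \<in> ?W - X \<Longrightarrow> f' e \<in> {f e + p, f e - p}"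
    "\<And>e. e \<in> arcs G - I - ?W - X \<Longrightarrow> f' e = f e"
    using shift_along_cotree[OF f I, of ?W p] by blast
  have nz': "nz_circulation G f'" using f'(1) by (simp add: shift_def)
  let ?W' = "{e \<in> arcs G - J - K. f' e \<in> B}"
  obtain g X' where g: "shift G f' g" "X' \<subseteq> arcs G" "card X' \<le> card {e \<in> arcs G. f' e \<in> {q, - q}}"
    "\<And>e. e \<in> arcs G \<Longrightarrow> g e \<in> {f' e, f' e + q, f' e - q}"
    "\<And>e. e \<in> ?W' - X' \<Longrightarrow> g e \<in> {f' e + q, f' e - q}"
    "\<And>e. e \<in> arcs G - J - ?W' - X' \<Longrightarrow> g e = f' e"
    using shift_along_cotree[OF nz' J, of ?W' q] by blast
  have f'_B': "f' e \<notin> B'" if "e \<in> arcs G - I - K - X" for e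
  proof (cases "f e \<in> B'")
    case True
    then have "f' e \<in> {f e + p, f e - p}" using f'(5)[of e] that by blast
    then show ?thesis using sep'[OF True] by auto
  next
    case False
    then have "f' e = f e" using f'(6)[of e] that by blast
    then show ?thesis using False by simp
  qed
  show ?thesis
  proof (rule that[of g "X \<union> X'"])
    show "(shift G)\<^sup>*\<^sup>* f g" using f'(1) g(1) by auto
    show "X \<union> X' \<subseteq> arcs G" using f'(2) g(2) by auto
    show "card (X \<union> X') \<le> 2 * card {e \<in> arcs G. f e \<in> octet p q}"
    proof -
      have "{e \<in> arcs G. f e \<in> {p, - p}} \<subseteq> {e \<in> arcs G. f e \<in> octet p q}"
        by (auto simp: octet_def)
      then have "card {e \<in> arcs G. f e \<in> {p, - p}} \<le> card {e \<in> arcs G. f e \<in> octet p q}"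
        by (intro card_mono) auto
      moreover have "{e \<in> arcs G. f' e \<in> {q, - q}} \<subseteq> {e \<in> arcs G. f e \<in> octet p q}"
      proof clarify
        fix e assume e: "e \<in> arcs G" "f' e \<in> {q, - q}"
        have "f e = f' e \<or> f e = f' e - p \<or> f e = f' e + p" using f'(4)[OF e(1)] by auto
        moreover have "f' e = q \<or> f' e = - q" using e(2) by simp
        ultimately show "f e \<in> octet p q" by (elim disjE) (simp_all add: octet_def)
      qed
      then have "card {e \<in> arcs G. f' e \<in> {q, - q}} \<le> card {e \<in> arcs G. f e \<in> octet p q}"
        by (intro card_mono) auto
      ultimately show ?thesis using f'(3) g(3) card_Un_le[of X X'] by linarith
    qed
    show "g e \<notin> B" if e: "e \<in> arcs G - K - (X \<union> X')" for e
    proof (cases "e \<in> J")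
      case True
      then have "f' e \<notin> B'" using f'_B'[of e] e IJ by blast
      then show ?thesis using g(4)[of e] e by (auto simp: B'_def)
    next
      case False
      show ?thesis
      proof (cases "f' e \<in> B")
        case True
        then have "g e \<in> {f' e + q, f' e - q}" using g(5)[of e] e False by blast
        then show ?thesis using sep[OF True] by auto
      next
        case nB: False
        then have "g e = f' e" using g(6)[of e] e False by blast
        then show ?thesis using nB by simp
      qed
    qed
    show "g e = f e" if "e \<in> K - (X \<union> X')" for e
    proof -
      have "f' e = f e" using f'(6)[of e] that K by blast
      moreover have "g e = f' e" using g(6)[of e] that K by blast
      ultimately show ?thesis by simp
    qed
  qed
qed

text \<open>
  If every small set can be avoided up to \<open>Suc N\<close> arcs, then every small set can be avoided up to \<open>N\<close>:
  avoid three disjoint octets up to \<open>Suc N\<close> arcs, and use the one that is hit least, at most a third as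
  often, to avoid \<open>B\<close>. The size 24 is that of three octets.
\<close>

lemma shifts_avoiding:
  fixes f :: "'b \<Rightarrow> 'c::{ab_group_add, finite}"
  assumes large: "4000 \<le> CARD('c)" and f: "nz_circulation G f"
    and I: "I \<subseteq> arcs G" "graph_rank G I = graph_rank G (arcs G)"
    and J: "J \<subseteq> arcs G" "graph_rank G J = graph_rank G (arcs G)"
    and IJ: "I \<inter> J = {}" and B: "card B \<le> 24"
  obtains g where "(shift G)\<^sup>*\<^sup>* f g" "\<And>e. e \<in> arcs G \<Longrightarrow> g e \<notin> B"
proof -
  define hits where "hits = (\<lambda>(g :: 'b \<Rightarrow> 'c) B. card {e \<in> arcs G. g e \<in> B})"
  define avoidable where "avoidable = (\<lambda>N. \<forall>B :: 'c set. card B \<le> 24 \<longrightarrow> (\<exists>g. (shift G)\<^sup>*\<^sup>* f g \<and> hits g B \<le> N))"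
  have start: "avoidable (card (arcs G))"
    unfolding avoidable_def hits_def by (intro allI impI exI[of _ f] conjI card_mono) auto
  have step: "avoidable N" if N: "avoidable (Suc N)" for N
    unfolding avoidable_def
  proof (intro allI impI)
    fix B :: "'c set" assume B: "card B \<le> 24"
    obtain p1 q1 where 1: "compatible B p1 q1"
      using ex_compatible[OF B _ large, of "{}"] by auto
    obtain p2 q2 where 2: "compatible B p2 q2" "octet p2 q2 \<inter> octet p1 q1 = {}"
      using ex_compatible[OF B _ large, of "octet p1 q1"] card_octet_le[of p1 q1] by auto
    let ?U = "octet p1 q1 \<union> octet p2 q2"
    have U: "card ?U \<le> 16"
      using card_Un_le[of "octet p1 q1" "octet p2 q2"] card_octet_le[of p1 q1] card_octet_le[of p2 q2] by linarith
    obtain p3 q3 where 3: "compatible B p3 q3" "octet p3 q3 \<inter> ?U = {}"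
      using ex_compatible[OF B _ large, of ?U] U by auto
    have "card (?U \<union> octet p3 q3) \<le> 24"
      using card_Un_le[of ?U "octet p3 q3"] card_octet_le[of p3 q3] U by linarith
    then obtain g where g: "(shift G)\<^sup>*\<^sup>* f g" "hits g (?U \<union> octet p3 q3) \<le> Suc N"
      using N unfolding avoidable_def by blast
    have add: "hits g (U \<union> V) = hits g U + hits g V" if "U \<inter> V = {}" for U V
    proof -
      have "{e \<in> arcs G. g e \<in> U \<union> V} = {e \<in> arcs G. g e \<in> U} \<union> {e \<in> arcs G. g e \<in> V}" by auto
      moreover have "{e \<in> arcs G. g e \<in> U} \<inter> {e \<in> arcs G. g e \<in> V} = {}" using that by auto
      ultimately show ?thesis unfolding hits_def by (simp add: card_Un_disjoint)
    qed
    have "hits g (octet p1 q1) + hits g (octet p2 q2) + hits g (octet p3 q3) \<le> Suc N"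
      using g(2) add[of ?U "octet p3 q3"] add[of "octet p1 q1" "octet p2 q2"] 2(2) 3(2)
      by (simp add: Int_commute)
    then have "3 * hits g (octet p1 q1) \<le> Suc N \<or> 3 * hits g (octet p2 q2) \<le> Suc N \<or> 3 * hits g (octet p3 q3) \<le> Suc N"
      by linarith
    then obtain p q where pq: "compatible B p q" "3 * hits g (octet p q) \<le> Suc N"
      using 1 2(1) 3(1) by blast
    obtain h X where h: "(shift G)\<^sup>*\<^sup>* g h" "X \<subseteq> arcs G" "card X \<le> 2 * card {e \<in> arcs G. g e \<in> octet p q}"
      "\<And>e. e \<in> arcs G - {} - X \<Longrightarrow> h e \<notin> B"
      by (rule shifts_avoiding_up_to[OF shifts_nz_circulation[OF g(1) f] I J IJ empty_subsetI pq(1)])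
        (rule that; assumption)
    have "hits h B \<le> card X"
      unfolding hits_def using h(2,4) by (intro card_mono finite_subset[OF h(2) finite_arcs]) auto
    also have "\<dots> \<le> N" using h(3) pq(2) unfolding hits_def by linarith
    finally show "\<exists>g. (shift G)\<^sup>*\<^sup>* f g \<and> hits g B \<le> N" using h(1) g(1) by (intro exI[of _ h]) auto
  qed
  have "avoidable N \<Longrightarrow> avoidable 0" for N
    by (induction N) (auto intro: step)
  from this[OF start] have "avoidable 0" .
  then obtain g where "(shift G)\<^sup>*\<^sup>* f g" "hits g B \<le> 0" using B unfolding avoidable_def by blast
  then show ?thesis by (intro that[of g]) (auto simp: hits_def)
qed

text \<open>
  The element \<open>x\<close> is known only after the octets have been avoided, so two pairs are prepared of which
  at least one is compatible with \<open>{x, -x}\<close>, whatever \<open>x\<close> is. The only differences in \<open>{x, -x}\<close> are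
  \<open>0\<close> and \<open>\<plusminus>2x\<close>, so it suffices that \<open>0\<close> lies in neither gap set and that the two gap sets,
  closed under negation, are disjoint. To this end the second pair is chosen compatible with \<open>0\<close> and the
  first gap set closed under negation.
\<close>

lemma shifts_equalize:
  fixes f :: "'b \<Rightarrow> 'c::{ab_group_add, finite}"
  assumes large: "4000 \<le> CARD('c)" and f: "nz_circulation G f"
    and ev: "even_digraph G" and no2: "\<And>S. card (cut G S) \<noteq> 2"
    and d: "d \<in> arcs G" "e \<in> arcs G" "d \<noteq> e"
  obtains g where "(shift G)\<^sup>*\<^sup>* f g" "g d = g e"
proof -
  have card_de: "card {d, e} \<le> 2" and finite_de: "finite {d, e}" by (simp_all add: card_insert_if)
  obtain I J where IJ: "I \<subseteq> arcs G - {d, e}" "J \<subseteq> arcs G - {d, e}" "I \<inter> J = {}"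
    "graph_rank G I = graph_rank G (arcs G)" "graph_rank G J = graph_rank G (arcs G)"
    by (rule two_disjoint_spanning[OF ev no2 card_de finite_de]) (rule that; assumption)
  have sub: "I \<subseteq> arcs G" "J \<subseteq> arcs G" using IJ by auto
  obtain p1 q1 :: 'c where 1: "compatible {0} p1 q1"
    using ex_compatible[OF _ _ large, of "{0}" "{}"] by auto
  let ?Y = "gap p1 q1 \<union> uminus ` gap p1 q1"
  have "card (gap p1 q1) \<le> 6" unfolding gap_def by (intro card_insert_le_m1) auto
  then have "card ?Y \<le> 6 + 6"
    using card_Un_le[of "gap p1 q1" "uminus ` gap p1 q1"] card_image_le[of "gap p1 q1" uminus] by simp
  then have "card (insert 0 ?Y) \<le> 24" by (simp add: card_insert_if)
  then obtain p2 q2 where 2: "compatible (insert 0 ?Y) p2 q2"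
    using ex_compatible[OF _ _ large, of "insert 0 ?Y" "{}"] by auto
  have one_fits: "compatible {x, - x} p1 q1 \<or> compatible {x, - x} p2 q2" for x
  proof (rule ccontr)
    assume no: "\<not> ?thesis"
    have diffs: "0 \<in> gap p q \<or> x + x \<in> gap p q \<or> - (x + x) \<in> gap p q"
      if "\<not> compatible {x, - x} p q" for p q
      using that by (auto simp: compatible_def)
    have "0 \<notin> gap p1 q1" using 1 by (simp add: compatible_def)
    then have "x + x \<in> ?Y" using diffs[of p1 q1] no
      by (metis Un_iff image_eqI minus_minus)
    then have "a - b \<notin> gap p2 q2" if "a \<in> {0, x + x}" "b \<in> {0, x + x}" for a b
      using 2 that unfolding compatible_def by blast
    from this[of 0 0] this[of "x + x" 0] this[of 0 "x + x"] show False
      using diffs[of p2 q2] no by simp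
  qed
  have "card (octet p1 q1 \<union> octet p2 q2) \<le> 24"
    using card_Un_le[of "octet p1 q1" "octet p2 q2"] card_octet_le[of p1 q1] card_octet_le[of p2 q2] by linarith
  then obtain g where g: "(shift G)\<^sup>*\<^sup>* f g" "\<And>x. x \<in> arcs G \<Longrightarrow> g x \<notin> octet p1 q1 \<union> octet p2 q2"
    by (rule shifts_avoiding[OF large f sub(1) IJ(4) sub(2) IJ(5) IJ(3)]) (rule that; assumption)
  define x where "x = g e - g d"
  obtain p q where pq: "compatible {x, - x} p q" "\<And>y. y \<in> arcs G \<Longrightarrow> g y \<notin> octet p q"
    using one_fits[of x] g(2) by blast
  have K: "{d, e} \<subseteq> arcs G - I - J" using d IJ by auto
  obtain h X where h: "(shift G)\<^sup>*\<^sup>* g h" "X \<subseteq> arcs G" "card X \<le> 2 * card {e \<in> arcs G. g e \<in> octet p q}"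
      "\<And>y. y \<in> arcs G - {d, e} - X \<Longrightarrow> h y \<notin> {x, - x}" "\<And>y. y \<in> {d, e} - X \<Longrightarrow> h y = g y"
    by (rule shifts_avoiding_up_to[OF shifts_nz_circulation[OF g(1) f] sub(1) IJ(4) sub(2) IJ(5) IJ(3) K pq(1)])
      (rule that; assumption)
  have none: "{e \<in> arcs G. g e \<in> octet p q} = {}" using pq(2) by auto
  have "card X = 0" using h(3) unfolding none by simp
  then have X: "X = {}" using finite_subset[OF h(2) finite_arcs] by simp
  have nzh: "nz_circulation G h"
    using shifts_nz_circulation[OF h(1)] shifts_nz_circulation[OF g(1) f] by simp
  have sp: "(tail G y, head G y) \<in> conn G I" if "y \<in> arcs G" for y
    using graph_rank_eq_imp_conn[OF sub(1) IJ(4) that] .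
  have W: "{d} \<subseteq> arcs G - I" using d IJ by auto
  obtain k :: "'b \<Rightarrow> int" where k: "circulation G k" "\<And>y. \<bar>k y\<bar> \<le> 1"
    "\<And>y. y \<in> arcs G - I \<Longrightarrow> k y \<noteq> 0 \<longleftrightarrow> y \<in> {d}"
    by (rule cotree_prescription[OF sub(1) order_refl sp W]) (assumption, (rule that; assumption))
  \<comment> \<open>The sign of \<open>k d\<close> is not prescribed; \<open>z\<close> compensates for it.\<close>
  define z where "z = (if k d = 1 then x else - x)"
  have zk: "zmul (k y) z = 0 \<and> k y = 0 \<or> zmul (k y) z \<in> {x, - x}" for y
    using zmul_unit_cases[OF k(2), of y z] by (auto simp: z_def)
  have kd: "zmul (k d) z = x" using zmul_unit_cases[OF k(2), of d z] k(3)[of d] W by (auto simp: z_def)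
  have ke: "k e = 0" using k(3)[of e] d IJ by auto
  let ?h = "\<lambda>y. h y + zmul (k y) z"
  have hd: "?h d = g e" "?h e = g e" using h(5) kd ke X by (auto simp: x_def)
  have "shift G h ?h"
  proof (rule shiftI[OF nzh k(1,2) refl])
    fix y assume y: "y \<in> arcs G"
    show "?h y \<noteq> 0"
    proof (cases "y \<in> {d, e}")
      case True
      then have "?h y = g e" using hd by auto
      moreover have "g e \<noteq> 0" using shifts_nz_circulation[OF g(1) f] d by (simp add: nz_circulation_def)
      ultimately show ?thesis by simp
    next
      case False
      then have "h y \<noteq> x" "h y \<noteq> - x" using h(4)[of y] y X by auto
      then have "h y + x \<noteq> 0" "h y - x \<noteq> 0" by (simp_all add: eq_neg_iff_add_eq_0)
      moreover have "?h y \<in> {h y, h y + x, h y - x}" using zk[of y] by auto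
      moreover have "h y \<noteq> 0" using nzh y by (simp add: nz_circulation_def)
      ultimately show ?thesis by auto
    qed
  qed
  then have "(shift G)\<^sup>*\<^sup>* f ?h" using g(1) h(1) by (meson rtranclp.rtrancl_into_rtrancl rtranclp_trans)
  then show ?thesis using hd by (intro that[of ?h]) auto
qed

end

section \<open>Reaching a constant flow\<close>

definition reaches_constant :: "('v, 'e) pre_digraph \<Rightarrow> ('e \<Rightarrow> 'a::ab_group_add) \<Rightarrow> 'a \<Rightarrow> bool" where
  "reaches_constant D f a \<longleftrightarrow> (\<exists>k :: 'e \<Rightarrow> int. circulation D k \<and> (\<forall>e\<in>arcs D. \<bar>k e\<bar> = 1) \<and>
     (shift D)\<^sup>*\<^sup>* f (\<lambda>e. zmul (k e) a))"

lemma reaches_constant_shifts: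
  "(shift D)\<^sup>*\<^sup>* f g \<Longrightarrow> reaches_constant D g a \<Longrightarrow> reaches_constant D f a"
  unfolding reaches_constant_def by (meson rtranclp_trans)

lemma nz_zmul: "\<bar>k\<bar> = 1 \<Longrightarrow> zmul k a = 0 \<longleftrightarrow> a = 0"
  using zmul_unit_cases[of k a] by auto

lemma shift_del_loop:
  fixes D :: "('v, 'e) pre_digraph" and f g :: "'e \<Rightarrow> 'a::ab_group_add"
  assumes "fin_digraph D" "e \<in> arcs D" "tail D e = head D e" "c \<noteq> 0" "shift (pre_digraph.del_arc D e) f g"
  shows "shift D (f(e := c)) (g(e := c))"
proof -
  interpret fin_digraph D by fact
  have lift: "circulation D (h(e := d))" if "circulation (pre_digraph.del_arc D e) h" for h :: "'e \<Rightarrow> 'x::ab_group_add" and d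
  proof -
    have "circulation (pre_digraph.del_arc D e) (h(e := d))"
      using that by (subst circulation_cong[of _ _ h]) (auto simp: pre_digraph.del_arc_def)
    then show ?thesis using net_out_del_loop[OF finite_arcs assms(2,3), of "h(e := d)"] by (simp add: circulation_def)
  qed
  obtain k :: "'e \<Rightarrow> int" and z where k: "nz_circulation (pre_digraph.del_arc D e) f" "nz_circulation (pre_digraph.del_arc D e) g"
    "circulation (pre_digraph.del_arc D e) k" "\<forall>x\<in>arcs (pre_digraph.del_arc D e). \<bar>k x\<bar> \<le> 1 \<and> g x = f x + zmul (k x) z"
    using assms(5) by (auto simp: shift_def)
  show ?thesis
  proof (rule shiftI[of _ _ "k(e := 0)" _ z])
    show "nz_circulation D (f(e := c))"
      using k(1) lift[of f c] assms(4) by (auto simp: nz_circulation_def pre_digraph.del_arc_def)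
  qed (use k lift assms(4) in \<open>auto simp: nz_circulation_def pre_digraph.del_arc_def\<close>)
qed

lemma reaches_constant_del_loop:
  fixes D :: "('v, 'e) pre_digraph" and f :: "'e \<Rightarrow> 'a::ab_group_add"
  assumes D: "fin_digraph D" "e \<in> arcs D" "tail D e = head D e" and f: "nz_circulation D f" and a: "a \<noteq> 0"
    and IH: "reaches_constant (pre_digraph.del_arc D e) f a"
  shows "reaches_constant D f a"
proof -
  interpret fin_digraph D by fact
  obtain k :: "'e \<Rightarrow> int" where k: "circulation (pre_digraph.del_arc D e) k" "\<forall>x\<in>arcs (pre_digraph.del_arc D e). \<bar>k x\<bar> = 1"
    "(shift (pre_digraph.del_arc D e))\<^sup>*\<^sup>* f (\<lambda>x. zmul (k x) a)" using IH by (auto simp: reaches_constant_def)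
  have fe: "f e \<noteq> 0" using f D(2) by (auto simp: nz_circulation_def)
  let ?g = "(\<lambda>x. zmul (k x) a)(e := f e)" and ?k = "k(e := 1)"
  have "(shift D)\<^sup>*\<^sup>* (f(e := f e)) ?g"
    using k(3) by (rule shifts_transfer[where L = "\<lambda>h. h(e := f e)", rotated])
      (rule shift_del_loop[OF D fe])
  then have reach: "(shift D)\<^sup>*\<^sup>* f ?g" by simp
  have single: "circulation D (\<lambda>x. if x = e then 1 else 0 :: int)"
    unfolding circulation_def using net_out_single[OF D(2), of "1 :: int"] D(3) by simp
  have "circulation (pre_digraph.del_arc D e) ?k"
    using k(1) by (subst circulation_cong[of _ _ k]) (auto simp: pre_digraph.del_arc_def)
  then have "circulation D ?k"
    using net_out_del_loop[OF finite_arcs D(2,3), of ?k] by (simp add: circulation_def)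
  moreover have "shift D ?g (\<lambda>x. zmul (?k x) a)"
  proof (rule shiftI[OF shifts_nz_circulation[OF reach f] single, where z = "a - f e"])
    fix x assume "x \<in> arcs D"
    then show "zmul (?k x) a \<noteq> 0" using k(2) a by (auto simp: nz_zmul pre_digraph.del_arc_def)
  qed auto
  ultimately show ?thesis using reach k(2)
    unfolding reaches_constant_def
    by (intro exI[of _ ?k] conjI rtranclp.rtrancl_into_rtrancl[OF reach]) (auto simp: pre_digraph.del_arc_def)
qed

lemma circulation_splice_lift:
  assumes "finite (arcs D)" "e \<in> arcs D" "e' \<in> arcs D" "e \<noteq> e'" "head D e = tail D e'"
    and "circulation (splice_arcs D e e') h"
  shows "circulation D (h(e' := h e))"
proof -
  have "circulation (splice_arcs D e e') (h(e' := h e))"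
    using assms(6) by (subst circulation_cong[of _ _ h]) (auto simp: splice_arcs_def)
  then show ?thesis
    using net_out_splice_arcs[OF assms(1-5), of "h(e' := h e)"] assms(4) by (simp add: circulation_def)
qed

text \<open>
  A common form of splicing, reversal and contraction: an operation on circulations, given for integer values by \<open>\<Phi>\<close>
  and for group values by \<open>\<Psi>\<close>, that copies every value on \<open>D\<close>, up to sign, from some arc of \<open>D'\<close>.
  Two functions stand for this one operation because a variable cannot range over polymorphic
  functions.
\<close>

lemma shift_lift:
  fixes \<Phi> :: "('e \<Rightarrow> int) \<Rightarrow> 'e \<Rightarrow> int" and \<Psi> :: "('e \<Rightarrow> 'a::ab_group_add) \<Rightarrow> 'e \<Rightarrow> 'a"
  assumes "\<And>k. circulation D' k \<Longrightarrow> circulation D (\<Phi> k)" "\<And>h. circulation D' h \<Longrightarrow> circulation D (\<Psi> h)"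
    and eval: "\<And>e. e \<in> arcs D \<Longrightarrow> \<exists>d\<in>arcs D'. \<exists>s\<in>{1, - 1}.
      (\<forall>k. \<Phi> k e = s * k d) \<and> (\<forall>h. \<Psi> h e = zmul s (h d))"
    and "shift D' f g"
  shows "shift D (\<Psi> f) (\<Psi> g)"
proof -
  obtain k :: "'e \<Rightarrow> int" and z where k: "nz_circulation D' f" "nz_circulation D' g"
    "circulation D' k" "\<forall>x\<in>arcs D'. \<bar>k x\<bar> \<le> 1 \<and> g x = f x + zmul (k x) z"
    using assms(4) by (auto simp: shift_def)
  have m1: "zmul (- 1) x = - x" for x :: 'a using zmul_minus[of 1 x] by simp
  show ?thesis
  proof (rule shiftI[of _ _ "\<Phi> k" _ z])
    show "nz_circulation D (\<Psi> f)"
      unfolding nz_circulation_def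
    proof (intro conjI ballI)
      fix e assume "e \<in> arcs D"
      from eval[OF this] show "\<Psi> f e \<noteq> 0" using k(1) by (auto simp: nz_circulation_def m1)
    qed (use assms(2) k(1) in \<open>simp add: nz_circulation_def\<close>)
  next
    fix e assume "e \<in> arcs D"
    from eval[OF this] obtain d s where ds: "d \<in> arcs D'" "s \<in> {1, - 1}"
      "\<forall>k. \<Phi> k e = s * k d" "\<forall>h. \<Psi> h e = zmul s (h d)" by blast
    show "\<bar>\<Phi> k e\<bar> \<le> 1" using ds k(4) by (auto simp: abs_mult)
    show "\<Psi> g e = \<Psi> f e + zmul (\<Phi> k e) z" using ds k(4) by (auto simp: m1)
    show "\<Psi> g e \<noteq> 0" using ds k(2) by (auto simp: nz_circulation_def m1)
  qed (use assms(1) k(3) in blast)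
qed

lemma reaches_constant_lift:
  fixes \<Phi> :: "('e \<Rightarrow> int) \<Rightarrow> 'e \<Rightarrow> int" and \<Psi> :: "('e \<Rightarrow> 'a::ab_group_add) \<Rightarrow> 'e \<Rightarrow> 'a"
  assumes "\<And>k. circulation D' k \<Longrightarrow> circulation D (\<Phi> k)" "\<And>h. circulation D' h \<Longrightarrow> circulation D (\<Psi> h)"
    and eval: "\<And>e. e \<in> arcs D \<Longrightarrow> \<exists>d\<in>arcs D'. \<exists>s\<in>{1, - 1}.
      (\<forall>k. \<Phi> k e = s * k d) \<and> (\<forall>h. \<Psi> h e = zmul s (h d))"
    and comm: "\<And>k. \<Psi> (\<lambda>e. zmul (k e) a) = (\<lambda>e. zmul (\<Phi> k e) a)"
    and "reaches_constant D' f a"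
  shows "reaches_constant D (\<Psi> f) a"
proof -
  obtain k :: "'e \<Rightarrow> int" where k: "circulation D' k" "\<forall>x\<in>arcs D'. \<bar>k x\<bar> = 1"
    "(shift D')\<^sup>*\<^sup>* f (\<lambda>x. zmul (k x) a)" using assms(5) by (auto simp: reaches_constant_def)
  have "(shift D)\<^sup>*\<^sup>* (\<Psi> f) (\<Psi> (\<lambda>x. zmul (k x) a))"
    using k(3) by (rule shifts_transfer[rotated]) (rule shift_lift[OF assms(1,2) eval])
  moreover have "\<bar>\<Phi> k e\<bar> = 1" if "e \<in> arcs D" for e
    using eval[OF that] k(2) by (auto simp: abs_mult)
  ultimately show ?thesis using assms(1)[OF k(1)] unfolding reaches_constant_def comm by blast
qed

lemma reaches_constant_splice:
  fixes D :: "('v, 'e) pre_digraph" and f :: "'e \<Rightarrow> 'a::ab_group_add"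
  assumes D: "finite (arcs D)" "e \<in> arcs D" "e' \<in> arcs D" "e \<noteq> e'" "head D e = tail D e'"
    and f: "f e = f e'" and IH: "reaches_constant (splice_arcs D e e') f a"
  shows "reaches_constant D f a"
proof -
  have "reaches_constant D (f(e' := f e)) a"
    by (rule reaches_constant_lift[where \<Psi> = "\<lambda>h. h(e' := h e)" and \<Phi> = "\<lambda>h. h(e' := h e)", OF _ _ _ _ IH])
      (use D in \<open>auto simp: splice_arcs_def intro: circulation_splice_lift\<close>)
  then show ?thesis using f by (simp add: fun_upd_idem)
qed

lemma reaches_constant_flip:
  fixes D :: "('v, 'e) pre_digraph" and f :: "'e \<Rightarrow> 'a::ab_group_add"
  assumes D: "finite (arcs D)" "e \<in> arcs D" and IH: "reaches_constant (flip D e) (f(e := - f e)) a"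
  shows "reaches_constant D f a"
proof -
  have lift: "circulation D (h(e := - h e))" if "circulation (flip D e) h" for h :: "'e \<Rightarrow> 'x::ab_group_add"
    using that net_out_flip[OF D(2,1), of "h(e := - h e)"] by (simp add: circulation_def)
  have m1: "zmul (- 1) x = - x" for x :: 'a using zmul_minus[of 1 x] by simp
  have "reaches_constant D ((f(e := - f e))(e := - (f(e := - f e)) e)) a"
  proof (rule reaches_constant_lift[where \<Psi> = "\<lambda>h. h(e := - h e)" and \<Phi> = "\<lambda>h. h(e := - h e)", OF _ _ _ _ IH])
    fix x assume x: "x \<in> arcs D"
    show "\<exists>d\<in>arcs (flip D e). \<exists>s\<in>{1, - 1}. (\<forall>k. (k(e := - k e)) x = s * k d) \<and>
        (\<forall>h :: 'e \<Rightarrow> 'a. (h(e := - h e)) x = zmul s (h d))"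
      by (rule bexI[of _ x], rule bexI[of _ "if x = e then - 1 else 1"])
        (use x in \<open>auto simp: flip_def m1\<close>)
  qed (auto intro: lift)
  then show ?thesis by simp
qed

text \<open>
  The value on the contracted arc is determined by the other arc of the cut. It makes the net outflow
  at both ends vanish: their sum vanishes after contraction, and the cut contributes a second
  equation, since \<open>S\<close> contains exactly one of the ends.
\<close>

lemma circulation_contract_lift:
  assumes D: "fin_digraph D" and cut: "cut D S = {d, e}" "d \<noteq> e"
    and h: "circulation (contract D d) h"
  shows "circulation D (h(d := if (tail D d \<in> S) = (tail D e \<in> S) then - h e else h e))" (is "circulation D ?h")
proof -
  interpret fin_digraph D by fact
  have d: "d \<in> arcs D" "(tail D d \<in> S) \<noteq> (head D d \<in> S)" using cut by (auto simp: cut_def)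
  let ?x = "head D d" and ?y = "tail D d"
  have "circulation (contract D d) ?h"
    using h by (subst circulation_cong[of _ _ h]) (auto simp: contract_def Let_def)
  then have zero: "net_out D ?h (id(?x := ?y) -` {v}) = 0" for v
    using net_out_contract[OF finite_arcs d(1), of ?h "{v}"] by (simp add: circulation_def)
  have other: "net_out D ?h {v} = 0" if "v \<noteq> ?x" "v \<noteq> ?y" for v
  proof -
    have "id(?x := ?y) -` {v} = {v}" using that by (auto split: if_splits)
    then show ?thesis using zero[of v] by simp
  qed
  have xy: "?x \<noteq> ?y" using d(2) by auto
  have "id(?x := ?y) -` {?y} = {?x, ?y}" by (auto split: if_splits)
  then have both: "net_out D ?h {?x} + net_out D ?h {?y} = 0"
    using zero[of ?y] xy net_out_eq_sum[of "{?x, ?y}" D ?h] by simp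
  have "net_out D ?h S = 0"
    using cut(2) by (simp add: net_out_cut cut(1))
  then have "0 = (\<Sum>v\<in>S \<inter> verts D. net_out D ?h {v})"
    using net_out_eq_sum[of "S \<inter> verts D" D ?h] by (simp add: net_out_Int_verts wf_digraph)
  also have "\<dots> = (\<Sum>v\<in>S \<inter> {?x, ?y}. net_out D ?h {v})"
    by (rule sum.mono_neutral_cong_right) (use d other in auto)
  finally have "net_out D ?h {?x} = 0 \<or> net_out D ?h {?y} = 0"
    using d(2) by (cases "?x \<in> S") auto
  with both have "net_out D ?h {?x} = 0" "net_out D ?h {?y} = 0" by auto
  then show ?thesis unfolding circulation_def using other by metis
qed

lemma reaches_constant_contract:
  fixes D :: "('v, 'e) pre_digraph" and f :: "'e \<Rightarrow> 'a::ab_group_add"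
  assumes D: "fin_digraph D" and cut: "cut D S = {d, e}" "d \<noteq> e" and f: "circulation D f"
    and IH: "reaches_constant (contract D d) f a"
  shows "reaches_constant D f a"
proof -
  interpret fin_digraph D by fact
  define P where "P \<longleftrightarrow> (tail D d \<in> S) = (tail D e \<in> S)"
  have e: "e \<in> arcs D" using cut(1) by (auto simp: cut_def)
  have m1: "zmul (- 1) x = - x" for x :: 'a using zmul_minus[of 1 x] by simp
  have lift: "circulation D (h(d := if P then - h e else h e))"
    if "circulation (contract D d) h" for h :: "'e \<Rightarrow> 'x::ab_group_add"
    using circulation_contract_lift[OF D cut that] by (simp add: P_def)
  have "reaches_constant D (f(d := if P then - f e else f e)) a"
  proof (rule reaches_constant_lift[where \<Psi> = "\<lambda>h. h(d := if P then - h e else h e)"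
        and \<Phi> = "\<lambda>h. h(d := if P then - h e else h e)", OF _ _ _ _ IH])
    fix x assume x: "x \<in> arcs D"
    show "\<exists>y\<in>arcs (contract D d). \<exists>s\<in>{1, - 1}.
        (\<forall>k. (k(d := if P then - k e else k e)) x = s * k y) \<and>
        (\<forall>h :: 'e \<Rightarrow> 'a. (h(d := if P then - h e else h e)) x = zmul s (h y))"
      by (rule bexI[of _ "if x = d then e else x"], rule bexI[of _ "if x = d \<and> P then - 1 else 1"])
        (use x e cut(2) in \<open>auto simp: contract_def Let_def m1\<close>)
  qed (erule lift, erule lift, auto)
  moreover have "f d = (if P then - f e else f e)"
  proof -
    have "(if tail D d \<in> S then f d else - f d) + (if tail D e \<in> S then f e else - f e) = 0"
      using net_out_eq_0[OF D f, of S] cut(2) by (simp add: net_out_cut cut(1))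
    then have "(if tail D e \<in> S then f e else - f e) = - (if tail D d \<in> S then f d else - f d)"
      by (simp only: add_eq_0_iff)
    then show ?thesis unfolding P_def
      by (cases "tail D d \<in> S"; cases "tail D e \<in> S") simp_all
  qed
  ultimately show ?thesis by (simp add: fun_upd_idem)
qed

text \<open>
  Loops and cuts of two arcs are reduced directly. Otherwise evenness yields a second arc at the head of
  any arc, reversed if necessary so that it leaves; the flow is equalized on the two arcs, and they are
  spliced.
\<close>

theorem even_digraph_reaches_constant:
  fixes f :: "'e \<Rightarrow> 'a::{ab_group_add, finite}" and D :: "('v, 'e) pre_digraph"
  assumes large: "4000 \<le> CARD('a)" and a: "a \<noteq> 0"
  shows "fin_digraph D \<Longrightarrow> even_digraph D \<Longrightarrow> nz_circulation D f \<Longrightarrow> reaches_constant D f a"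
proof (induction "card (arcs D)" arbitrary: D f rule: less_induct)
  case (less D f)
  interpret fin_digraph D by (rule less.prems(1))
  have merge: "reaches_constant H h a"
    if H: "fin_digraph H" "even_digraph H" "nz_circulation H h" "card (arcs H) = card (arcs D)"
      and no2: "\<And>S. card (cut H S) \<noteq> 2"
      and e: "d \<in> arcs H" "e \<in> arcs H" "d \<noteq> e" "head H d = tail H e"
    for H :: "('v, 'e) pre_digraph" and h d e
  proof -
    have fin: "finite (arcs H)" using H(1) by (rule fin_digraph.finite_arcs)
    obtain g where g: "(shift H)\<^sup>*\<^sup>* h g" "g d = g e"
      by (rule fin_digraph.shifts_equalize[OF H(1) large H(3,2) no2 e(1-3)]) (rule that; assumption)
    have nz: "nz_circulation H g" by (rule shifts_nz_circulation[OF g(1) H(3)])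
    have "reaches_constant (splice_arcs H d e) g a"
    proof (rule less.hyps)
      show "card (arcs (splice_arcs H d e)) < card (arcs D)"
        using card_Diff1_less[OF fin e(2)] H(4) by (simp add: splice_arcs_def)
      show "fin_digraph (splice_arcs H d e)" by (rule fin_digraph_splice_arcs[OF H(1) e(2)])
      show "even_digraph (splice_arcs H d e)"
        using H(2) net_out_splice_arcs[OF fin e, of "\<lambda>_. 1 :: int"] by (simp add: even_digraph_def)
      show "nz_circulation (splice_arcs H d e) g"
        using nz net_out_splice_arcs[OF fin e g(2)]
        by (auto simp: nz_circulation_def circulation_def splice_arcs_def)
    qed
    then have "reaches_constant H g a" by (rule reaches_constant_splice[OF fin e g(2)])
    then show ?thesis by (rule reaches_constant_shifts[OF g(1)])
  qed
  consider (empty) "arcs D = {}" | (loop) e where "e \<in> arcs D" "tail D e = head D e"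
    | (series) S where "card (cut D S) = 2"
    | (main) e where "e \<in> arcs D" "tail D e \<noteq> head D e" "\<And>S. card (cut D S) \<noteq> 2"
    by blast
  then show ?case
  proof cases
    case empty
    then have "shift D f (\<lambda>e. zmul ((\<lambda>_. 1) e) a)" "circulation D (\<lambda>_. 1 :: int)"
      by (auto simp: shift_def nz_circulation_def circulation_def net_out_def)
    then show ?thesis using empty unfolding reaches_constant_def by (intro exI[of _ "\<lambda>_. 1"]) auto
  next
    case loop
    have "reaches_constant (pre_digraph.del_arc D e) f a"
    proof (rule less.hyps)
      show "card (arcs (pre_digraph.del_arc D e)) < card (arcs D)"
        using card_Diff1_less[OF finite_arcs loop(1)] by (simp add: pre_digraph.del_arc_def)
      show "nz_circulation (pre_digraph.del_arc D e) f" "even_digraph (pre_digraph.del_arc D e)"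
        using less.prems(2,3) net_out_del_loop[OF finite_arcs loop, of f]
          net_out_del_loop[OF finite_arcs loop, of "\<lambda>_. 1 :: int"]
        by (auto simp: nz_circulation_def circulation_def even_digraph_def pre_digraph.del_arc_def)
    qed (rule fin_digraph_delete[OF less.prems(1)])
    then show ?thesis by (rule reaches_constant_del_loop[OF less.prems(1) loop less.prems(3) a])
  next
    case series
    then obtain d e where de: "cut D S = {d, e}" "d \<noteq> e" by (meson card_2_iff)
    then have d: "d \<in> arcs D" by (auto simp: cut_def)
    have "reaches_constant (contract D d) f a"
    proof (rule less.hyps)
      show "card (arcs (contract D d)) < card (arcs D)"
        using card_Diff1_less[OF finite_arcs d] by (simp add: contract_def Let_def)
      show "nz_circulation (contract D d) f"
        using less.prems(3) net_out_contract[OF finite_arcs d, of f] net_out_eq_0[OF less.prems(1), of f]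
        by (auto simp: nz_circulation_def circulation_def contract_def Let_def)
      show "even_digraph (contract D d)"
        unfolding even_digraph_def net_out_contract[OF finite_arcs d]
        using even_net_out_one[OF less.prems(1,2)] by blast
    qed (rule fin_digraph_contract[OF less.prems(1) d])
    then show ?thesis
      using less.prems(3) by (intro reaches_constant_contract[OF less.prems(1) de]) (auto simp: nz_circulation_def)
  next
    case main
    let ?v = "head D e"
    have "cut D {?v} \<noteq> {e}" using even_card_cut[OF less.prems(1,2), of "{?v}"] by auto
    moreover have "e \<in> cut D {?v}" using main by (auto simp: cut_def)
    ultimately obtain e' where e': "e' \<in> cut D {?v}" "e' \<noteq> e" by blast
    then have e'D: "e' \<in> arcs D" by (auto simp: cut_def)
    show ?thesis
    proof (cases "tail D e' = ?v")
      case True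
      then show ?thesis using merge[OF less.prems refl main(3) main(1) e'D] e'(2) by auto
    next
      case False
      then have h: "head D e' = ?v" using e'(1) by (auto simp: cut_def)
      have "reaches_constant (flip D e') (f(e' := - f e')) a"
      proof (rule merge)
        show "fin_digraph (flip D e')" "even_digraph (flip D e')"
          using less.prems e'D by (simp_all add: fin_digraph_flip even_digraph_flip)
        show "nz_circulation (flip D e') (f(e' := - f e'))"
          using less.prems(3) net_out_flip[OF e'D finite_arcs, of f]
          by (auto simp: nz_circulation_def circulation_def flip_def)
        show "card (arcs (flip D e')) = card (arcs D)" by (simp add: flip_def)
        show "card (cut (flip D e') S) \<noteq> 2" for S
        proof -
          have "cut (flip D e') S = cut D S" by (auto simp: cut_def flip_def)
          then show ?thesis using main(3) by simp
        qed
        show "e \<in> arcs (flip D e')" "e' \<in> arcs (flip D e')" "e \<noteq> e'"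
          "head (flip D e') e = tail (flip D e') e'"
          using main e'D e'(2) h by (auto simp: flip_def)
      qed
      then show ?thesis by (rule reaches_constant_flip[OF finite_arcs e'D])
    qed
  qed
qed

text \<open>
  Where the two orientations differ, the value is negated, which is a change by \<open>a + a\<close> or its negative;
  half the difference of the two sign functions is again a circulation.
\<close>

lemma shift_constants:
  fixes k l :: "'e \<Rightarrow> int" and a :: "'a::ab_group_add"
  assumes k: "circulation D k" "\<forall>e\<in>arcs D. \<bar>k e\<bar> = 1"
    and l: "circulation D l" "\<forall>e\<in>arcs D. \<bar>l e\<bar> = 1" and a: "a \<noteq> 0"
  shows "shift D (\<lambda>e. zmul (k e) a) (\<lambda>e. zmul (l e) a)"
proof -
  let ?c = "\<lambda>e. (l e - k e) div 2"
  have cases: "k e = l e \<and> ?c e = 0 \<or> k e = - 1 \<and> l e = 1 \<and> ?c e = 1 \<or> k e = 1 \<and> l e = - 1 \<and> ?c e = - 1"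
    if "e \<in> arcs D" for e
  proof -
    have "k e = 1 \<or> k e = - 1" "l e = 1 \<or> l e = - 1" using k(2) l(2) that by (auto simp: abs_eq_iff')
    then show ?thesis by (elim disjE) simp_all
  qed
  have m1: "zmul (- 1) x = - x" for x :: 'a using zmul_minus[of 1 x] by simp
  show ?thesis
  proof (rule shiftI[of _ _ ?c _ "a + a"])
    show "nz_circulation D (\<lambda>e. zmul (k e) a)"
      using k a by (auto simp: nz_circulation_def nz_zmul circulation_zmul)
    have "net_out D ?c {v} = 0" for v
    proof -
      have "net_out D ?c {v} + net_out D ?c {v} = net_out D (\<lambda>e. l e + - k e) {v}"
        unfolding net_out_add[symmetric] using cases by (intro net_out_cong) fastforce
      also have "\<dots> = 0"
        using k(1) l(1) by (simp only: net_out_add net_out_minus) (simp add: circulation_def)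
      finally show ?thesis by simp
    qed
    then show "circulation D ?c" by (simp add: circulation_def)
  next
    fix e assume e: "e \<in> arcs D"
    show "\<bar>?c e\<bar> \<le> 1" using cases[OF e] by (elim disjE conjE) simp_all
    show "zmul (l e) a = zmul (k e) a + zmul (?c e) (a + a)"
      using cases[OF e] by (elim disjE conjE) (simp_all add: m1)
    show "zmul (l e) a \<noteq> 0" using l(2) e a by (simp add: nz_zmul)
  qed
qed

lemma even_digraph_shift_connected:
  fixes f g :: "'e \<Rightarrow> 'a::{ab_group_add, finite}" and D :: "('v, 'e) pre_digraph"
  assumes large: "4000 \<le> CARD('a)" and D: "fin_digraph D" "even_digraph D"
    and f: "nz_circulation D f" and g: "nz_circulation D g"
  shows "(shift D)\<^sup>*\<^sup>* f g"
proof -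
  have "\<exists>a :: 'a. a \<noteq> 0"
  proof (rule ccontr)
    assume "\<not> ?thesis"
    then have "(UNIV :: 'a set) = {0}" by auto
    then have "CARD('a) = 1" by (metis card_1_singleton_iff One_nat_def)
    then show False using large by simp
  qed
  then obtain a :: 'a where a: "a \<noteq> 0" by blast
  obtain k :: "'e \<Rightarrow> int" where k: "circulation D k" "\<forall>e\<in>arcs D. \<bar>k e\<bar> = 1"
    "(shift D)\<^sup>*\<^sup>* f (\<lambda>e. zmul (k e) a)"
    using even_digraph_reaches_constant[OF large a D f] by (auto simp: reaches_constant_def)
  obtain l :: "'e \<Rightarrow> int" where l: "circulation D l" "\<forall>e\<in>arcs D. \<bar>l e\<bar> = 1"
    "(shift D)\<^sup>*\<^sup>* g (\<lambda>e. zmul (l e) a)"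
    using even_digraph_reaches_constant[OF large a D g] by (auto simp: reaches_constant_def)
  have "(shift D)\<^sup>*\<^sup>* f (\<lambda>e. zmul (l e) a)"
    using k(3) shift_constants[OF k(1,2) l(1,2) a] by simp
  also have "(shift D)\<^sup>*\<^sup>* (\<lambda>e. zmul (l e) a) g" by (rule shifts_sym[OF l(3)])
  finally show ?thesis .
qed

section \<open>Cycles in a circulation\<close>

text \<open>
  Direct the support of \<open>k\<close> by the signs of \<open>k\<close>. Whenever an arc enters a vertex, another one leaves it,
  so choosing one leaving arc per vertex gives a self-map of a finite set of vertices, and a periodic
  orbit of this map is a directed cycle.
\<close>

lemma cycle_in_circulation:
  fixes G :: "('v, 'e) multigraph" and k :: "'e \<Rightarrow> int"
  assumes G: "multigraph G" and D: "orientation D G"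
    and k: "circulation D k" "\<And>e. e \<in> arcs D \<Longrightarrow> \<bar>k e\<bar> \<le> 1" and nz: "\<exists>e\<in>arcs D. k e \<noteq> 0"
  obtains C :: "('v, 'e) multigraph" where "subgraph_of C G" "cycle C" "edges C \<noteq> {}"
    "edges C \<subseteq> {e \<in> arcs D. k e \<noteq> 0}" "circulation D (\<lambda>e. if e \<in> edges C then k e else 0)"
proof -
  define H where "H = {e \<in> arcs D. k e \<noteq> 0}"
  define src where "src = (\<lambda>e. if k e = 1 then tail D e else head D e)"
  define tgt where "tgt = (\<lambda>e. if k e = 1 then head D e else tail D e)"
  have arcs: "arcs D = edges G" using D by (simp add: orientation_def)
  have finA: "finite (arcs D)" using G arcs by (simp add: multigraph_def)
  have finH: "finite H" using finA by (simp add: H_def)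
  have ends: "ends G e = {src e, tgt e}" "src e \<noteq> tgt e" "e \<in> edges G" "src e \<in> vertices G" if "e \<in> H" for e
  proof -
    have e: "e \<in> edges G" using that arcs by (simp add: H_def)
    then show "e \<in> edges G" .
    have "ends G e = {tail D e, head D e}" using D e by (simp add: orientation_def)
    then show *: "ends G e = {src e, tgt e}" by (auto simp: src_def tgt_def)
    have "card (ends G e) = 2" "ends G e \<subseteq> vertices G" using G e by (auto simp: multigraph_def)
    then show "src e \<noteq> tgt e" "src e \<in> vertices G" using * by auto
  qed
  have kval: "k e = 1 \<or> k e = - 1" if "e \<in> H" for e
    using k(2)[of e] that by (auto simp: H_def abs_if split: if_splits)
  have net: "net_out D (\<lambda>e. if e \<in> F then k e else 0) {v}
      = (\<Sum>e\<in>F. of_bool (src e = v) - of_bool (tgt e = v))" if "F \<subseteq> H" for F v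
  proof -
    have "net_out D (\<lambda>e. if e \<in> F then k e else 0) {v}
        = (\<Sum>e\<in>F. (if tail D e \<in> {v} then k e else 0) - (if head D e \<in> {v} then k e else 0))"
      unfolding net_out_def using that finA by (intro sum.mono_neutral_cong_right) (auto simp: H_def)
    also have "\<dots> = (\<Sum>e\<in>F. of_bool (src e = v) - of_bool (tgt e = v))"
    proof (rule sum.cong[OF refl])
      fix e assume "e \<in> F"
      then show "(if tail D e \<in> {v} then k e else 0) - (if head D e \<in> {v} then k e else 0)
          = of_bool (src e = v) - of_bool (tgt e = v)"
        using kval[of e] that by (auto simp: src_def tgt_def)
    qed
    finally show ?thesis .
  qed
  have onward: "\<exists>e'\<in>H. src e' = tgt e" if e: "e \<in> H" for e
  proof (rule ccontr)
    assume no: "\<not> ?thesis"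
    have "net_out D (\<lambda>e. if e \<in> H then k e else 0) {tgt e} = 0"
      using k(1) circulation_cong[of D "\<lambda>e. if e \<in> H then k e else 0" k]
      by (auto simp: circulation_def H_def)
    then have "(\<Sum>x\<in>H. of_bool (src x = tgt e) - of_bool (tgt x = tgt e) :: int) = 0"
      using net[of H "tgt e"] by simp
    moreover have "(\<Sum>x\<in>H. of_bool (src x = tgt e) - of_bool (tgt x = tgt e) :: int)
        = - (\<Sum>x\<in>H. of_bool (tgt x = tgt e))"
      unfolding sum_negf[symmetric] using no by (intro sum.cong) auto
    ultimately have "(\<Sum>x\<in>H. of_bool (tgt x = tgt e) :: int) = 0" by simp
    then show False using e finH by (subst (asm) sum_nonneg_eq_0_iff) auto
  qed
  define V where "V = src ` H"
  have "\<forall>v\<in>V. \<exists>e. e \<in> H \<and> src e = v" by (auto simp: V_def)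
  from bchoice[OF this] obtain out where out: "\<forall>v\<in>V. out v \<in> H \<and> src (out v) = v" ..
  define succ where "succ = (\<lambda>v. tgt (out v))"
  have "succ v \<in> V" if v: "v \<in> V" for v
  proof -
    have "out v \<in> H" using out v by blast
    from onward[OF this] obtain e' where "e' \<in> H" "src e' = succ v" by (auto simp: succ_def)
    then show ?thesis unfolding V_def by (intro image_eqI) auto
  qed
  then have "V \<subseteq> V \<and> V \<noteq> {} \<and> succ ` V \<subseteq> V" using nz by (auto simp: V_def H_def)
  \<comment> \<open>On a minimal nonempty set closed under \<open>succ\<close>, the map \<open>succ\<close> is a bijection with a single orbit:
    this is the vertex set of a cycle.\<close>
  then obtain S where S: "S \<subseteq> V" "S \<noteq> {}" "succ ` S \<subseteq> S"
    and min: "\<And>T. T \<subseteq> V \<and> T \<noteq> {} \<and> succ ` T \<subseteq> T \<Longrightarrow> card S \<le> card T"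
    using ex_has_least_nat[of "\<lambda>T. T \<subseteq> V \<and> T \<noteq> {} \<and> succ ` T \<subseteq> T" V card] by auto
  have finS: "finite S" using S(1) finH finite_subset unfolding V_def by blast
  have whole: "T = S" if "T \<subseteq> S" "T \<noteq> {}" "succ ` T \<subseteq> T" for T
    using min[of T] that S(1) card_mono[OF finS that(1)] by (intro card_subset_eq[OF finS]) auto
  have surj: "succ ` S = S" using S by (intro whole) auto
  then have inj: "inj_on succ S" using finS by (simp add: eq_card_imp_inj_on)
  have outS: "out v \<in> H" "src (out v) = v" "tgt (out v) = succ v" if "v \<in> S" for v
    using out that S(1) by (auto simp: succ_def)
  have inj_out: "inj_on out S" using outS(2) by (metis inj_onI)
  let ?C = "\<lparr>vertices = S, edges = out ` S, ends = ends G\<rparr> :: ('v, 'e) multigraph"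
  have SV: "S \<subseteq> vertices G" using outS ends(4) by force
  have mC: "multigraph ?C"
    unfolding multigraph_def
  proof (intro conjI ballI)
    fix e assume "e \<in> edges ?C"
    then obtain v where v: "v \<in> S" "e = out v" by auto
    show "ends ?C e \<subseteq> vertices ?C" using ends(1) outS[OF v(1)] v S(3) by auto
    show "card (ends ?C e) = 2" using ends(1,2)[OF outS(1)[OF v(1)]] v by simp
  qed (use finS in auto)
  show ?thesis
  proof (rule that[of ?C])
    show "subgraph_of ?C G" using mC SV outS(1) ends(3) by (auto simp: subgraph_of_def)
    show "edges ?C \<noteq> {}" using S(2) by simp
    show "edges ?C \<subseteq> {e \<in> arcs D. k e \<noteq> 0}" using outS(1) by (auto simp: H_def)
    have "connected_graph ?C"
      unfolding connected_graph_def
    proof (intro conjI ballI)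
      fix u v assume u: "u \<in> vertices ?C" and v: "v \<in> vertices ?C"
      let ?T = "{w \<in> S. (u, w) \<in> (adjacency ?C)\<^sup>*}"
      have "(w, succ w) \<in> adjacency ?C" if "w \<in> S" for w
        using that ends(1)[OF outS(1)[OF that]] outS[OF that] by (auto simp: adjacency_def)
      then have "succ ` ?T \<subseteq> ?T" using S(3) by (auto intro: rtrancl.rtrancl_into_rtrancl)
      then have "?T = S" using u by (intro whole) auto
      then show "(u, v) \<in> (adjacency ?C)\<^sup>*" using v by auto
    qed (use S(2) in simp)
    moreover have "degree ?C v = 2" if "v \<in> vertices ?C" for v
    proof -
      have v: "v \<in> S" using that by simp
      then have "v \<in> succ ` S" by (simp add: surj)
      then obtain u where u: "u \<in> S" "succ u = v" by blast
      have "{e \<in> edges ?C. v \<in> ends ?C e} = {out v, out u}"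
      proof (intro set_eqI iffI)
        fix e assume "e \<in> {e \<in> edges ?C. v \<in> ends ?C e}"
        then obtain w where w: "w \<in> S" "e = out w" "v \<in> ends G (out w)" by auto
        then have "v = w \<or> v = succ w" using ends(1)[OF outS(1)[OF w(1)]] outS[OF w(1)] by auto
        then show "e \<in> {out v, out u}" using w u inj by (auto dest: inj_onD)
      next
        fix e assume "e \<in> {out v, out u}"
        then show "e \<in> {e \<in> edges ?C. v \<in> ends ?C e}"
          using u v ends(1)[OF outS(1)[OF v]] ends(1)[OF outS(1)[OF u(1)]] outS[OF v] outS[OF u(1)] by auto
      qed
      moreover have "u \<noteq> v" using ends(2)[OF outS(1)[OF u(1)]] outS[OF u(1)] u(2) by auto
      then have "out v \<noteq> out u" using inj_out u v by (auto dest: inj_onD)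
      ultimately show ?thesis unfolding degree_def by simp
    qed
    ultimately show "cycle ?C" using mC by (auto simp: cycle_def)
    have "net_out D (\<lambda>e. if e \<in> out ` S then k e else 0) {v} = 0" for v
    proof -
      have "out ` S \<subseteq> H" using outS(1) by auto
      then have "net_out D (\<lambda>e. if e \<in> out ` S then k e else 0) {v}
          = (\<Sum>e\<in>out ` S. of_bool (src e = v) - of_bool (tgt e = v))" by (rule net)
      also have "\<dots> = (\<Sum>w\<in>S. of_bool (w = v) - of_bool (succ w = v))"
        using outS by (simp add: sum.reindex[OF inj_out])
      also have "\<dots> = (\<Sum>w\<in>S. of_bool (w = v)) - (\<Sum>w\<in>S. of_bool (succ w = v))"
        by (rule sum_subtractf)
      also have "(\<Sum>w\<in>S. of_bool (succ w = v) :: int) = (\<Sum>w\<in>succ ` S. of_bool (w = v))"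
        by (simp add: sum.reindex[OF inj])
      finally show ?thesis by (simp add: surj)
    qed
    then show "circulation D (\<lambda>e. if e \<in> edges ?C then k e else 0)" by (simp add: circulation_def)
  qed
qed

section \<open>From shifts to moves along cycles\<close>

lemma fin_digraph_orientation: "multigraph G \<Longrightarrow> orientation D G \<Longrightarrow> fin_digraph D"
  unfolding fin_digraph_def wf_digraph_def fin_digraph_axioms_def multigraph_def orientation_def
  by auto

lemma nz_flow_iff_nz_circulation:
  assumes "fin_digraph D"
  shows "nz_flow D f \<longleftrightarrow> f \<in> extensional (arcs D) \<and> nz_circulation D f"
proof -
  interpret fin_digraph D by fact
  have net: "(\<Sum>e\<in>out_arcs D v. f e) - (\<Sum>e\<in>in_arcs D v. f e) = net_out D f {v}" for v
    unfolding net_out_def sum_subtractf out_arcs_def in_arcs_def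
    by (simp add: sum.inter_filter)
  have "net_out D f {v} = 0" if "v \<notin> verts D" for v
    unfolding net_out_def using that by (intro sum.neutral) auto
  then have "(\<forall>v\<in>verts D. net_out D f {v} = 0) \<longleftrightarrow> circulation D f"
    unfolding circulation_def by blast
  then show ?thesis
    unfolding nz_flow_def net nz_circulation_def by (auto simp: PiE_def Pi_def)
qed

text \<open>
  Split off one directed cycle of the support at a time. On each arc the intermediate flows have the
  value of \<open>f\<close> or of \<open>g\<close>. The restrictions make them \<open>undefined\<close> off the arc set, as equality of flows
  requires.
\<close>

lemma shift_imp_equivalent_flows:
  fixes G :: "('v, 'e) multigraph" and f g :: "'e \<Rightarrow> 'a::ab_group_add"
  assumes G: "multigraph G" and D: "orientation D G" and "shift D f g"
  shows "equivalent_flows G D (restrict f (arcs D)) (restrict g (arcs D))"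
proof -
  have finD: "fin_digraph D" by (rule fin_digraph_orientation[OF G D])
  interpret fin_digraph D by fact
  have nz_restrict: "nz_flow D (restrict h (arcs D)) \<longleftrightarrow> nz_circulation D h" for h :: "'e \<Rightarrow> 'a"
    using circulation_cong[of D "restrict h (arcs D)" h]
    by (auto simp: nz_flow_iff_nz_circulation[OF finD] nz_circulation_def)
  obtain k :: "'e \<Rightarrow> int" and z where k: "nz_circulation D f" "nz_circulation D g" "circulation D k"
    "\<forall>e\<in>arcs D. \<bar>k e\<bar> \<le> 1 \<and> g e = f e + zmul (k e) z" using assms(3) by (auto simp: shift_def)
  then show ?thesis
  proof (induction "card {e \<in> arcs D. k e \<noteq> 0}" arbitrary: f k rule: less_induct)
    case less
    show ?case
    proof (cases "\<exists>e\<in>arcs D. k e \<noteq> 0")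
      case False
      then have "restrict f (arcs D) = restrict g (arcs D)"
        using less.prems(4) by (intro restrict_ext) auto
      then show ?thesis by (simp add: equivalent_flows_def)
    next
      case True
      obtain C :: "('v, 'e) multigraph" where C: "subgraph_of C G" "cycle C" "edges C \<noteq> {}"
        "edges C \<subseteq> {e \<in> arcs D. k e \<noteq> 0}" "circulation D (\<lambda>e. if e \<in> edges C then k e else 0)"
        by (rule cycle_in_circulation[OF G D less.prems(3) _ True]) (use less.prems(4) in auto)
      let ?c = "\<lambda>e. if e \<in> edges C then k e else 0"
      let ?h = "\<lambda>e. f e + zmul (?c e) z" and ?k = "\<lambda>e. k e + - ?c e"
      have h: "nz_circulation D ?h"
        using less.prems(1,2,4) C(5)
        by (auto simp: nz_circulation_def intro!: circulation_add circulation_zmul)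
      have k': "circulation D ?k" by (intro circulation_add circulation_minus less.prems(3) C(5))
      have "{e \<in> arcs D. ?k e \<noteq> 0} \<subset> {e \<in> arcs D. k e \<noteq> 0}" using C(3,4) by auto
      then have "card {e \<in> arcs D. ?k e \<noteq> 0} < card {e \<in> arcs D. k e \<noteq> 0}"
        by (intro psubset_card_mono) auto
      moreover have "\<forall>e\<in>arcs D. \<bar>?k e\<bar> \<le> 1 \<and> g e = ?h e + zmul (?k e) z"
        using less.prems(4) by auto
      ultimately have "equivalent_flows G D (restrict ?h (arcs D)) (restrict g (arcs D))"
        by (intro less.hyps[of ?k ?h] h k' less.prems(2))
      moreover have "adjacent_flows G (restrict f (arcs D)) (restrict ?h (arcs D))"
        unfolding adjacent_flows_def using C(1,2) by (intro exI[of _ C]) (auto simp: restrict_def)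
      ultimately show ?thesis
        unfolding equivalent_flows_def using nz_restrict less.prems(1) h
        by (intro converse_rtranclp_into_rtranclp[of _ "restrict f (arcs D)" "restrict ?h (arcs D)"]) auto
    qed
  qed
qed

lemma shifts_imp_equivalent_flows:
  assumes "multigraph G" "orientation D G" "(shift D)\<^sup>*\<^sup>* f g"
  shows "equivalent_flows G D (restrict f (arcs D)) (restrict g (arcs D))"
  using assms(3)
proof induction
  case (step g h)
  then show ?case
    using shift_imp_equivalent_flows[OF assms(1,2) step.hyps(2)]
    unfolding equivalent_flows_def by (rule_tac rtranclp_trans)
qed (simp add: equivalent_flows_def)

lemma even_digraph_orientation:
  assumes G: "multigraph G" "eulerian G" and D: "orientation D G"
  shows "even_digraph D"
  unfolding even_digraph_def
proof
  fix v
  have arcs: "arcs D = edges G" "finite (edges G)" using D G by (auto simp: orientation_def multigraph_def)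
  have ends: "ends G e = {tail D e, head D e}" if "e \<in> edges G" for e using D that by (simp add: orientation_def)
  have "even (degree G v)"
  proof (cases "v \<in> vertices G")
    case False
    then have none: "{e \<in> edges G. v \<in> ends G e} = {}" using G(1) by (auto simp: multigraph_def)
    show ?thesis unfolding degree_def none by simp
  qed (use G in \<open>simp add: eulerian_def\<close>)
  moreover have "cut D {v} = {e \<in> edges G. v \<in> ends G e}"
  proof -
    have "tail D e \<noteq> head D e" "head D e \<noteq> tail D e" if "e \<in> edges G" for e
      using G(1) that ends[OF that] by (fastforce simp: multigraph_def)+
    then show ?thesis using ends arcs by (auto simp: cut_def)
  qed
  ultimately have "even (card (cut D {v}))" by (simp add: degree_def)
  moreover have "finite (cut D {v})" using arcs by (simp add: cut_def)
  moreover have "odd (if tail D e \<in> {v} then 1 else - 1 :: int)" for e by simp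
  ultimately have "even (\<Sum>e\<in>cut D {v}. if tail D e \<in> {v} then 1 else - 1 :: int)"
    by (subst even_sum_iff) auto
  then show "even (net_out D (\<lambda>_. 1 :: int) {v})" using arcs by (simp add: net_out_cut)
qed

theorem corollary4p5:
  fixes G :: "('v, 'e) multigraph"
  assumes "multigraph G"
    and "eulerian G"
    and "CARD('a) \<ge> 62 * (56^2 * 27 + 27) + 1"
  shows "flow_connected TYPE('a::{ab_group_add, finite}) G"
  unfolding flow_connected_def
proof (intro allI impI)
  fix D and f g :: "'e \<Rightarrow> 'a"
  assume D: "orientation D G" and f: "nz_flow D f" and g: "nz_flow D g"
  have finD: "fin_digraph D" by (rule fin_digraph_orientation[OF assms(1) D])
  have fg: "nz_circulation D f" "nz_circulation D g" "f \<in> extensional (arcs D)" "g \<in> extensional (arcs D)"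
    using f g by (simp_all add: nz_flow_iff_nz_circulation[OF finD])
  have "4000 \<le> CARD('a)" using assms(3) by simp
  then have "(shift D)\<^sup>*\<^sup>* f g"
    by (rule even_digraph_shift_connected[OF _ finD even_digraph_orientation[OF assms(1,2) D] fg(1,2)])
  then show "equivalent_flows G D f g"
    using shifts_imp_equivalent_flows[OF assms(1) D] fg(3,4) by (metis extensional_restrict)
qed

end
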